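(* Let $H_3$ be the 3-dimensional Heisenberg group, realized as $\mathbb R^3$ with multiplication $$(x^1,x^2,x^3)\cdot(y^1,y^2,y^3)=(x^1+y^1,\;x^2+y^2+x^1y^3,\;x^3+y^3),$$ equipped with the singular (non $y$-global) left-invariant Berwald--Moór Finsler metric $$\mathcal F(x,y)=\big(y^1\,(y^2-x^1y^3)\,y^3\big)^{2/3},\qquad x\in H_3,\ y=(y^1,y^2,y^3)\in T_xH_3 .$$ Then the curvature algebra $\mathfrak r_x$ of $(H_3,\mathcal F)$ at any point $x\in H_3$ is a Lie algebra of infinite dimension.
   Context: A singular (non $y$-global) Finsler space is a manifold with a metric function $\mathcal F$, positively homogeneous of degree two in $y$, required to be smooth (with non-degenerate $g_{ij}$) only on an open cone bundle $\mathcal CM=\bigcup_x\mathcal C_xM\subset TM\setminus\{0\}$, each $\mathcal C_xM$ being an open cone in $T_xM\setminus\{0\}$; here $\mathcal C_xH_3$ is the cone where $y^1(y^2-x^1y^3)y^3\neq0$. All objects below are considered on this cone. The metric $\mathcal F$ is the left-invariant metric $\mathcal F(x,y)=\mathcal F_0(x^{-1}y)$ with $\mathcal F_0(a)=(a^1a^2a^3)^{2/3}$ on the Lie algebra $T_0H_3$. Put $g_{ij}(x,y)=\frac12\frac{\partial^2\mathcal F}{\partial y^i\partial y^j}$, $G^i(x,y)=\frac14 g^{il}\big(2\frac{\partial g_{jl}}{\partial x^k}-\frac{\partial g_{jk}}{\partial x^l}\big)y^jy^k$, $\Gamma^i_j=\frac{\partial G^i}{\partial y^j}$ and $R^k_{ij}=\frac{\partial\Gamma^k_i}{\partial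 x^j}-\frac{\partial\Gamma^k_j}{\partial x^i}+\Gamma^m_i\frac{\partial\Gamma^k_j}{\partial y^m}-\Gamma^m_j\frac{\partial\Gamma^k_i}{\partial y^m}$. For $X,Y\in T_xM$ the curvature vector field is $r_x(X,Y)(y)=R^k_{ij}(x,y)X^iY^j\frac{\partial}{\partial y^k}$; it is tangent to the indicatrix $\mathfrak I_xM=\{y:\mathcal F(x,y)=\pm1\}$. The curvature algebra at $x$ (denoted $\mathfrak r_x$ here) is the Lie subalgebra of the Lie algebra $\mathfrak X(\mathfrak I_xM)$ of smooth vector fields on the indicatrix generated by all curvature vector fields $r_x(X,Y)$, $X,Y\in T_xM$. *)

theory Defs
  imports "HOL-Analysis.Analysis" "HOL-Library.Function_Algebras"
begin

definition heis_mult :: "real^3 \<Rightarrow> real^3 \<Rightarrow> real^3" where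
  "heis_mult x y = vector [x$1 + y$1, x$2 + y$2 + x$1 * y$3, x$3 + y$3]"

definition berwald_moor_cone :: "real^3 \<Rightarrow> (real^3) set" where
  "berwald_moor_cone x = {y. y$1 * (y$2 - x$1 * y$3) * y$3 \<noteq> 0}"

text \<open>
  The exponent \<open>2/3\<close> is read as the square of the real cube root, since the base takes both
  signs on the cone (\<open>powr\<close> is only meant for nonnegative bases).
\<close>

definition berwald_moor :: "real^3 \<Rightarrow> real^3 \<Rightarrow> real" where
  "berwald_moor x y = (root 3 (y$1 * (y$2 - x$1 * y$3) * y$3))\<^sup>2"

lemma berwald_moor_left_invariant:
  "berwald_moor (heis_mult z x) (frechet_derivative (heis_mult z) (at x) y) = berwald_moor x y"
proof -
  have "(heis_mult z has_derivative (\<lambda>v. vector [v$1, v$2 + z$1 * v$3, v$3])) (at x)"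
    unfolding has_derivative_componentwise_within [of "heis_mult z"] Basis_vec_def
    by (auto simp: heis_mult_def inner_axis forall_3 intro!: derivative_eq_intros
        bounded_linear_imp_has_derivative [OF bounded_linear_vec_nth])
  then have "frechet_derivative (heis_mult z) (at x) = (\<lambda>v. vector [v$1, v$2 + z$1 * v$3, v$3])"
    by (rule frechet_derivative_at [symmetric])
  then show ?thesis
    by (simp add: berwald_moor_def heis_mult_def algebra_simps)
qed

definition partial_x :: "3 \<Rightarrow> (real^3 \<Rightarrow> real^3 \<Rightarrow> real) \<Rightarrow> real^3 \<Rightarrow> real^3 \<Rightarrow> real" where
  "partial_x k f x y = deriv (\<lambda>t. f (x + t *\<^sub>R axis k 1) y) 0"

definition partial_y :: "3 \<Rightarrow> (real^3 \<Rightarrow> real^3 \<Rightarrow> real) \<Rightarrow> real^3 \<Rightarrow> real^3 \<Rightarrow> real" where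
  "partial_y k f x y = deriv (\<lambda>t. f x (y + t *\<^sub>R axis k 1)) 0"

definition metric_tensor :: "3 \<Rightarrow> 3 \<Rightarrow> real^3 \<Rightarrow> real^3 \<Rightarrow> real" where
  "metric_tensor i j = (\<lambda>x y. 1/2 * partial_y i (partial_y j berwald_moor) x y)"

definition metric_inverse :: "3 \<Rightarrow> 3 \<Rightarrow> real^3 \<Rightarrow> real^3 \<Rightarrow> real" where
  "metric_inverse i j = (\<lambda>x y. matrix_inv (\<chi> k l. metric_tensor k l x y) $ i $ j)"

definition spray_coeff :: "3 \<Rightarrow> real^3 \<Rightarrow> real^3 \<Rightarrow> real" where
  "spray_coeff i = (\<lambda>x y. 1/4 * (\<Sum>l\<in>UNIV. \<Sum>j\<in>UNIV. \<Sum>k\<in>UNIV. metric_inverse i l x y *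
     (2 * partial_x k (metric_tensor j l) x y - partial_x l (metric_tensor j k) x y) * y$j * y$k))"

definition connection :: "3 \<Rightarrow> 3 \<Rightarrow> real^3 \<Rightarrow> real^3 \<Rightarrow> real" where
  "connection i j = partial_y j (spray_coeff i)"

text \<open>\<open>curvature k i j\<close> is \<open>R\<close> with upper index \<open>k\<close> and lower indices \<open>i\<close>, \<open>j\<close>.\<close>

definition curvature :: "3 \<Rightarrow> 3 \<Rightarrow> 3 \<Rightarrow> real^3 \<Rightarrow> real^3 \<Rightarrow> real" where
  "curvature k i j = (\<lambda>x y.
     partial_x j (connection k i) x y - partial_x i (connection k j) x y
     + (\<Sum>m\<in>UNIV. connection m i x y * partial_y m (connection k j) x y
                 - connection m j x y * partial_y m (connection k i) x y))"

definition indicatrix :: "real^3 \<Rightarrow> (real^3) set" where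
  "indicatrix x = {y \<in> berwald_moor_cone x. berwald_moor x y = 1 \<or> berwald_moor x y = -1}"

primrec Ck_on :: "nat \<Rightarrow> (real^3 \<Rightarrow> real^3) \<Rightarrow> (real^3) set \<Rightarrow> bool" where
  "Ck_on 0 f U \<longleftrightarrow> continuous_on U f"
| "Ck_on (Suc n) f U \<longleftrightarrow> (\<forall>y\<in>U. f differentiable (at y)) \<and>
     (\<forall>v. Ck_on n (\<lambda>y. frechet_derivative f (at y) v) U)"

text \<open>
  A smooth vector field on the indicatrix, a surface embedded in the open cone, is represented
  by a map into \<open>\<real>\<^sup>3\<close> that is tangent to the indicatrix (it annihilates the differential of the
  metric function), that extends smoothly to an open neighbourhood, and that is set to
  \<open>0\<close> off the indicatrix, so that equality of functions is equality of vector fields.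
\<close>

definition smooth_fields :: "real^3 \<Rightarrow> (real^3 \<Rightarrow> real^3) set" where
  "smooth_fields x = {X.
     (\<forall>y. y \<notin> indicatrix x \<longrightarrow> X y = 0) \<and>
     (\<forall>y\<in>indicatrix x. frechet_derivative (berwald_moor x) (at y) (X y) = 0) \<and>
     (\<exists>U X'. open U \<and> indicatrix x \<subseteq> U \<and> (\<forall>n. Ck_on n X' U) \<and> (\<forall>y\<in>indicatrix x. X y = X' y))}"

text \<open>
  Derivatives within the indicatrix are determined only on vectors tangent to it, but they are
  evaluated only on such vectors. For any smooth extensions \<open>X'\<close>, \<open>Y'\<close> of \<open>X\<close>, \<open>Y\<close> the bracket
  below is the restriction of the usual bracket \<open>DY' X' - DX' Y'\<close> of vector fields on an open
  set.
\<close>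

definition lie_bracket ::
  "real^3 \<Rightarrow> (real^3 \<Rightarrow> real^3) \<Rightarrow> (real^3 \<Rightarrow> real^3) \<Rightarrow> real^3 \<Rightarrow> real^3" where
  "lie_bracket x X Y = (\<lambda>y. if y \<in> indicatrix x
     then frechet_derivative Y (at y within indicatrix x) (X y)
        - frechet_derivative X (at y within indicatrix x) (Y y)
     else 0)"

definition scale_field :: "real \<Rightarrow> (real^3 \<Rightarrow> real^3) \<Rightarrow> real^3 \<Rightarrow> real^3" where
  "scale_field c X = (\<lambda>y. c *\<^sub>R X y)"

interpretation vfield: vector_space scale_field
  by unfold_locales (auto simp: scale_field_def fun_eq_iff algebra_simps)

definition lie_subalgebra :: "real^3 \<Rightarrow> (real^3 \<Rightarrow> real^3) set \<Rightarrow> bool" where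
  "lie_subalgebra x S \<longleftrightarrow> S \<subseteq> smooth_fields x \<and> vfield.subspace S \<and>
     (\<forall>X\<in>S. \<forall>Y\<in>S. lie_bracket x X Y \<in> S)"

definition curvature_field :: "real^3 \<Rightarrow> real^3 \<Rightarrow> real^3 \<Rightarrow> real^3 \<Rightarrow> real^3" where
  "curvature_field x X Y = (\<lambda>y. if y \<in> indicatrix x
     then (\<chi> k. \<Sum>i\<in>UNIV. \<Sum>j\<in>UNIV. curvature k i j x y * X$i * Y$j) else 0)"

definition curvature_algebra :: "real^3 \<Rightarrow> (real^3 \<Rightarrow> real^3) set" where
  "curvature_algebra x = lie_subalgebra x hull {curvature_field x X Y | X Y. True}"

definition infinite_dimensional :: "(real^3 \<Rightarrow> real^3) set \<Rightarrow> bool" where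
  "infinite_dimensional S \<longleftrightarrow> \<not> (\<exists>B. finite B \<and> S \<subseteq> vfield.span B)"

end

theory Submission
  imports Defs
begin

text \<open>
  Write \<open>a = (y\<^sup>1, y\<^sup>2 - x\<^sup>1 y\<^sup>3, y\<^sup>3)\<close> for the components of \<open>y\<close> in the left-invariant frame. The metric is
  \<open>(a\<^sup>1 a\<^sup>2 a\<^sup>3)\<^bsup>2/3\<^esup>\<close>, so the indicatrix is \<open>\<bar>a\<^sup>1 a\<^sup>2 a\<^sup>3\<bar> = 1\<close>: eight orbits, one in each octant, of the
  two-dimensional group of positive diagonal matrices of determinant \<open>1\<close>. A linear field \<open>(c\<^sup>1 a\<^sup>1, c\<^sup>2 a\<^sup>2, c\<^sup>3 a\<^sup>3)\<close> with
  \<open>c\<^sup>1 + c\<^sup>2 + c\<^sup>3 = 0\<close> generates a one-parameter subgroup and is tangent to the indicatrix, and so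
  is its product \<open>a\<^sup>m c\<close> with a Laurent monomial \<open>a\<^sup>m\<close>. These monomial fields satisfy the Witt-type relation
  \<open>[a\<^sup>m c, a\<^sup>n d] = a\<^bsup>m+n\<^esup> ((n \<cdot> c) d - (m \<cdot> d) c)\<close> (lemma \<open>lie_bracket_monomial_field\<close>).

  With \<open>w = a\<^sup>1 a\<^sup>3 / a\<^sup>2\<close> the geodesic spray of the metric has frame components \<open>w/2 (-a\<^sup>1, -a\<^sup>2, a\<^sup>3)\<close>. It is a
  rational map, and each curvature field is a linear combination of three monomial fields
  (lemma \<open>curvature_field_monomial\<close>), with exponents \<open>(1,-3,2)\<close>, \<open>(1,-2,1)\<close> and \<open>(2,-3,1)\<close>. Take
  \<open>X = a\<^sup>m c\<close> with \<open>m = (1,-2,1)\<close> and \<open>c = (1,0,-1)\<close>, and let \<open>Z\<close> be the field with exponent \<open>n = (1,-3,2)\<close>.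
  Since \<open>m \<cdot> c = 0\<close> and \<open>n \<cdot> c = -1\<close>, each application of \<open>ad X\<close> multiplies the coefficient vector by \<open>-1\<close>, up
  to a multiple of \<open>c\<close>. The second entry of \<open>c\<close> is \<open>0\<close>, so the second coefficient of \<open>(ad X)\<^sup>k Z\<close> is \<open>1/4\<close>
  up to sign and never vanishes. Along the curve \<open>a = (s, 1/s, 1)\<close> in the indicatrix the second components of these
  fields are nonzero multiples of \<open>s\<^bsup>3k+3\<^esup>\<close>; hence the fields are linearly independent
  (lemma \<open>infinite_dimensional_ladder\<close>).

  The curvature algebra is defined as an intersection of Lie subalgebras of the smooth fields. That it is one itself
  requires that this family is not empty. It contains the space of all smooth fields, which is closed under the
  bracket (lemma \<open>lie_subalgebra_smooth_fields\<close>): for a bracket, smoothness comes from the calculus of \<open>C\<^sup>n\<close> maps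
  in the first part, and tangency from the symmetry of the second differential of \<open>log \<bar>a\<^sup>1 a\<^sup>2 a\<^sup>3\<bar>\<close>.
\<close>

section \<open>Maps of class C^n on open sets\<close>

text \<open>
  On an open set the derivative at a point is determined by the values nearby, so at every order only the values on
  the set matter. A map can thus be replaced by a formula that agrees with it on the set.
\<close>

lemma Ck_on_cong:
  assumes "open U" "\<And>y. y \<in> U \<Longrightarrow> f y = g y" "Ck_on n f U"
  shows "Ck_on n g U"
  using assms(2,3)
proof (induction n arbitrary: f g)
  case 0
  then show ?case by (auto cong: continuous_on_cong)
next
  case (Suc n)
  have D: "(g has_derivative frechet_derivative f (at y)) (at y)" if y: "y \<in> U" for y
  proof -
    have "(f has_derivative frechet_derivative f (at y)) (at y)"
      using Suc.prems(2) y by (simp add: frechet_derivative_works)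
    then show ?thesis
      by (rule has_derivative_transform_within_open[OF _ \<open>open U\<close> y]) (simp add: Suc.prems(1))
  qed
  show ?case
  proof (clarsimp, intro conjI ballI allI)
    show "g differentiable (at y)" if "y \<in> U" for y
      using D[OF that] by (auto simp: differentiable_def)
    show "Ck_on n (\<lambda>y. frechet_derivative g (at y) v) U" for v
    proof (rule Suc.IH)
      show "Ck_on n (\<lambda>y. frechet_derivative f (at y) v) U"
        using Suc.prems(2) by simp
    qed (metis D frechet_derivative_at)
  qed
qed

lemma Ck_on_SucI:
  assumes "open U" "\<And>y. y \<in> U \<Longrightarrow> (f has_derivative F y) (at y)" "\<And>v. Ck_on n (\<lambda>y. F y v) U"
  shows "Ck_on (Suc n) f U"
proof (clarsimp, intro conjI ballI allI)
  show "f differentiable (at y)" if "y \<in> U" for y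
    using assms(2)[OF that] by (auto simp: differentiable_def)
  show "Ck_on n (\<lambda>y. frechet_derivative f (at y) v) U" for v
    by (rule Ck_on_cong[OF assms(1) _ assms(3)[of v]]) (metis assms(2) frechet_derivative_at)
qed

lemma Ck_on_SucD:
  assumes "Ck_on (Suc n) f U"
  shows "Ck_on n f U"
  using assms
proof (induction n arbitrary: f)
  case 0
  then show ?case
    by (auto intro: differentiable_imp_continuous_on simp: differentiable_on_def
        differentiable_at_withinI)
next
  case (Suc n)
  then show ?case by simp
qed

lemma Ck_on_Suc_has_derivative:
  "Ck_on (Suc n) f U \<Longrightarrow> y \<in> U \<Longrightarrow> (f has_derivative frechet_derivative f (at y)) (at y)"
  by (simp add: frechet_derivative_works)

lemma Ck_on_subset: "Ck_on n f U \<Longrightarrow> V \<subseteq> U \<Longrightarrow> Ck_on n f V"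
proof (induction n arbitrary: f)
  case 0
  then show ?case using continuous_on_subset by auto
qed auto

lemma Ck_on_const: "Ck_on n (\<lambda>y. c) U"
  by (induction n arbitrary: c) auto

lemma Ck_on_linear:
  assumes "open U" "bounded_linear f"
  shows "Ck_on n f U"
proof (cases n)
  case 0
  then show ?thesis using assms by (simp add: linear_continuous_on)
next
  case (Suc m)
  then show ?thesis
    using Ck_on_SucI[OF assms(1), of f "\<lambda>_. f"] assms(2) Ck_on_const
    by (auto intro: bounded_linear_imp_has_derivative)
qed

lemma Ck_on_add:
  assumes "open U" "Ck_on n f U" "Ck_on n g U"
  shows "Ck_on n (\<lambda>y. f y + g y) U"
  using assms(2,3)
proof (induction n arbitrary: f g)
  case 0
  then show ?case by (simp add: continuous_on_add continuous_on_scaleR continuous_on_component)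
next
  case (Suc n)
  note D = Ck_on_Suc_has_derivative[OF Suc.prems(1)] Ck_on_Suc_has_derivative[OF Suc.prems(2)]
  show ?case
  proof (rule Ck_on_SucI[OF \<open>open U\<close>])
    show "((\<lambda>y. f y + g y) has_derivative
        (\<lambda>v. frechet_derivative f (at y) v + frechet_derivative g (at y) v)) (at y)"
      if "y \<in> U" for y
      by (intro has_derivative_add D that)
  qed (use Suc in auto)
qed

text \<open>
  \<open>Ck_on\<close> is a property of maps into \<open>\<real>\<^sup>3\<close>, so scalar factors enter as components of such maps. By the
  product rule the derivative is a sum of two products of the same shape, which closes the induction on \<open>n\<close>.
\<close>

lemma Ck_on_scaleR_nth:
  assumes "open U" "Ck_on n f U" "Ck_on n g U"
  shows "Ck_on n (\<lambda>y. g y $ i *\<^sub>R f y) U"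
  using assms(2,3)
proof (induction n arbitrary: f g)
  case 0
  then show ?case by (simp add: continuous_on_add continuous_on_scaleR continuous_on_component)
next
  case (Suc n)
  note D = Ck_on_Suc_has_derivative[OF Suc.prems(1)] Ck_on_Suc_has_derivative[OF Suc.prems(2)]
  show ?case
  proof (rule Ck_on_SucI[OF \<open>open U\<close>])
    show "((\<lambda>y. g y $ i *\<^sub>R f y) has_derivative
        (\<lambda>v. g y $ i *\<^sub>R frechet_derivative f (at y) v + frechet_derivative g (at y) v $ i *\<^sub>R f y))
        (at y)" if "y \<in> U" for y
      by (intro has_derivative_scaleR D that bounded_linear.has_derivative[OF bounded_linear_vec_nth])
    show "Ck_on n (\<lambda>y. g y $ i *\<^sub>R frechet_derivative f (at y) v
        + frechet_derivative g (at y) v $ i *\<^sub>R f y) U" for v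
      using Suc.prems Ck_on_SucD[OF Suc.prems(1)] Ck_on_SucD[OF Suc.prems(2)]
      by (intro Ck_on_add[OF \<open>open U\<close>] Suc.IH) auto
  qed
qed

lemma Ck_on_scaleR:
  assumes "open U" "Ck_on n f U"
  shows "Ck_on n (\<lambda>y. c *\<^sub>R f y) U"
  using Ck_on_scaleR_nth[OF assms Ck_on_const[of n "\<chi> i. c"]] by simp

text \<open>
  The derivative of \<open>f / g\<^sub>i\<close> is \<open>Df / g\<^sub>i - (Dg)\<^sub>i f / g\<^sub>i\<^sup>2\<close>. For the second term the induction hypothesis is used
  twice with the same \<open>g\<close>, which is why only \<open>f\<close> is generalized.
\<close>

lemma Ck_on_inverse_nth:
  assumes "open U" "Ck_on n f U" "Ck_on n g U" and nz: "\<And>y. y \<in> U \<Longrightarrow> g y $ i \<noteq> 0"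
  shows "Ck_on n (\<lambda>y. inverse (g y $ i) *\<^sub>R f y) U"
  using assms(2,3)
proof (induction n arbitrary: f)
  case 0
  then show ?case
    by (auto intro!: continuous_on_scaleR continuous_on_inverse continuous_on_component nz)
next
  case (Suc n)
  note D = Ck_on_Suc_has_derivative[OF Suc.prems(1)] Ck_on_Suc_has_derivative[OF Suc.prems(2)]
  note S = Ck_on_SucD[OF Suc.prems(1)] Ck_on_SucD[OF Suc.prems(2)]
  show ?case
  proof (rule Ck_on_SucI[OF \<open>open U\<close>])
    show "((\<lambda>y. inverse (g y $ i) *\<^sub>R f y) has_derivative
        (\<lambda>v. inverse (g y $ i) *\<^sub>R frechet_derivative f (at y) v
           + (- (inverse (g y $ i) * frechet_derivative g (at y) v $ i * inverse (g y $ i))) *\<^sub>R f y))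
        (at y)" if "y \<in> U" for y
      by (intro has_derivative_scaleR[OF _ D(1)[OF that]] Deriv.has_derivative_inverse nz[OF that]
          bounded_linear.has_derivative[OF bounded_linear_vec_nth D(2)[OF that]])
    have "Ck_on n (\<lambda>y. inverse (g y $ i) *\<^sub>R frechet_derivative f (at y) v
        + (-1) *\<^sub>R (inverse (g y $ i) *\<^sub>R (inverse (g y $ i) *\<^sub>R
            (frechet_derivative g (at y) v $ i *\<^sub>R f y)))) U" for v
      using Suc.prems
      by (intro Ck_on_add[OF \<open>open U\<close>] Ck_on_scaleR[OF \<open>open U\<close>] Suc.IH
          Ck_on_scaleR_nth[OF \<open>open U\<close>] S) auto
    then show "Ck_on n (\<lambda>y. inverse (g y $ i) *\<^sub>R frechet_derivative f (at y) v
        + (- (inverse (g y $ i) * frechet_derivative g (at y) v $ i * inverse (g y $ i))) *\<^sub>R f y) U" for v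
      by (simp add: mult_ac)
  qed
qed

lemma Ck_on_power_int_nth:
  assumes "open U" "Ck_on n f U" "Ck_on n g U" "\<And>y. y \<in> U \<Longrightarrow> g y $ i \<noteq> 0"
  shows "Ck_on n (\<lambda>y. (g y $ i powi k) *\<^sub>R f y) U"
proof -
  have pos: "Ck_on n (\<lambda>y. (g y $ i) ^ m *\<^sub>R f y) U" for m
  proof (induction m)
    case (Suc m)
    from Ck_on_scaleR_nth[OF assms(1) this assms(3), of i] show ?case by simp
  qed (use assms in simp)
  have neg: "Ck_on n (\<lambda>y. inverse (g y $ i) ^ m *\<^sub>R f y) U" for m
  proof (induction m)
    case (Suc m)
    from Ck_on_inverse_nth[OF assms(1) this assms(3,4)] show ?case by simp
  qed (use assms in simp)
  show ?thesis
    using pos neg by (cases k rule: int_cases4) (auto simp: power_int_minus power_inverse)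
qed

text \<open>
  The direction \<open>g y\<close> varies with the point, so it is expanded in the standard basis: then only derivatives in
  constant directions remain, which are \<open>C\<^sup>n\<close> by definition.
\<close>

lemma Ck_on_frechet_derivative:
  assumes "open U" "Ck_on (Suc n) f U" "Ck_on n g U"
  shows "Ck_on n (\<lambda>y. frechet_derivative f (at y) (g y)) U"
proof -
  have eq: "(\<Sum>i\<in>UNIV. g y $ i *\<^sub>R frechet_derivative f (at y) (axis i 1))
      = frechet_derivative f (at y) (g y)" if "y \<in> U" for y
  proof -
    have "linear (frechet_derivative f (at y))"
      using Ck_on_Suc_has_derivative[OF assms(2) that] has_derivative_linear by blast
    from linear_sum[OF this, of "\<lambda>i. g y $ i *\<^sub>R axis i 1" UNIV] linear_scale[OF this]
    show ?thesis by (metis (no_types, lifting) basis_expansion scalar_mult_eq_scaleR sum.cong)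
  qed
  have "Ck_on n (\<lambda>y. \<Sum>i\<in>UNIV. g y $ i *\<^sub>R frechet_derivative f (at y) (axis i 1)) U"
    unfolding sum_3 using assms
    by (intro Ck_on_add Ck_on_scaleR_nth) auto
  then show ?thesis
    by (rule Ck_on_cong[OF assms(1), rotated]) (rule eq)
qed

section \<open>Frame coordinates and the indicatrix\<close>

text \<open>
  Components of a tangent vector at \<open>x\<close> with respect to the left-invariant frame.
\<close>

definition coords :: "real^3 \<Rightarrow> real^3 \<Rightarrow> real^3" where
  "coords x y = vector [y$1, y$2 - x$1 * y$3, y$3]"

text \<open>
  The action of diagonal matrices in frame coordinates, written in standard coordinates.
\<close>

definition dilate :: "real^3 \<Rightarrow> real^3 \<Rightarrow> real^3 \<Rightarrow> real^3" where
  "dilate x c y = vector [c$1 * y$1, c$2 * (y$2 - x$1 * y$3) + x$1 * (c$3 * y$3), c$3 * y$3]"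

text \<open>
  The differential of \<open>log \<bar>a\<^sup>1 a\<^sup>2 a\<^sup>3\<bar>\<close> at \<open>y\<close> applied to \<open>v\<close>; its kernel at a point of the indicatrix is the
  tangent plane.
\<close>

definition log_sum :: "real^3 \<Rightarrow> real^3 \<Rightarrow> real^3 \<Rightarrow> real" where
  "log_sum x y v = (\<Sum>i\<in>UNIV. coords x v $ i / coords x y $ i)"

lemma coords_nth [simp]:
  "coords x y $ 1 = y$1" "coords x y $ 2 = y$2 - x$1 * y$3" "coords x y $ 3 = y$3"
  by (simp_all add: coords_def)

lemma coords_dilate [simp]: "coords x (dilate x c y) $ i = c$i * coords x y $ i"
  using exhaust_3[of i] by (auto simp: dilate_def algebra_simps)

lemma coords_inject: "coords x y = coords x z \<longleftrightarrow> y = z"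
  by (auto simp: vec_eq_iff forall_3)

lemma bounded_linear_coords_nth: "bounded_linear (\<lambda>y. coords x y $ i)"
proof -
  have "bounded_linear (\<lambda>y::real^3. y$2 - x$1 * y$3)"
    by (intro bounded_linear_sub bounded_linear_vec_nth bounded_linear_const_mult)
  then show ?thesis
    using exhaust_3[of i] by (auto intro: bounded_linear_vec_nth)
qed

lemma bounded_linear_coords: "bounded_linear (coords x)"
proof -
  have "bounded_linear (\<lambda>y. \<Sum>i\<in>UNIV. coords x y $ i *\<^sub>R axis i (1::real))"
    by (intro bounded_linear_sum bounded_linear_compose[OF bounded_linear_scaleR_left]
        bounded_linear_coords_nth)
  moreover have "(\<lambda>y. \<Sum>i\<in>UNIV. coords x y $ i *\<^sub>R axis i (1::real)) = coords x"
    by (simp add: fun_eq_iff basis_expansion flip: scalar_mult_eq_scaleR)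
  ultimately show ?thesis by simp
qed

lemmas coords_add = bounded_linear.linear[OF bounded_linear_coords, THEN linear_add]
  and coords_diff = bounded_linear.linear[OF bounded_linear_coords, THEN linear_diff]
  and coords_scaleR = bounded_linear.linear[OF bounded_linear_coords, THEN linear_scale]

lemma bounded_linear_dilate: "bounded_linear (dilate x c)"
  unfolding linear_conv_bounded_linear[symmetric]
  by (rule linearI) (simp_all add: dilate_def vec_eq_iff forall_3 algebra_simps)

lemma dilate_1 [simp]: "dilate x (\<chi> i. 1) y = y"
  by (rule coords_inject[THEN iffD1, of x]) (simp add: vec_eq_iff)

lemma dilate_eqI: "(\<And>i. coords x v $ i = c $ i * coords x y $ i) \<Longrightarrow> dilate x c y = v"
  by (rule coords_inject[THEN iffD1, of x]) (simp add: vec_eq_iff)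

lemma cone_iff_coords: "y \<in> berwald_moor_cone x \<longleftrightarrow> (\<forall>i. coords x y $ i \<noteq> 0)"
  by (simp add: berwald_moor_cone_def forall_3)

lemma open_berwald_moor_cone: "open (berwald_moor_cone x)"
  unfolding berwald_moor_cone_def
  by (intro open_Collect_neq continuous_on_mult continuous_on_diff continuous_on_component
      continuous_on_id continuous_on_const)

lemma prod_UNIV_3: "prod f (UNIV::3 set) = f 1 * f 2 * f 3"
  unfolding UNIV_3 by (simp add: ac_simps)

lemma berwald_moor_coords: "berwald_moor x y = (root 3 (\<Prod>i\<in>UNIV. coords x y $ i))\<^sup>2"
  by (simp add: berwald_moor_def prod_UNIV_3)

lemma indicatrix_subset_cone: "indicatrix x \<subseteq> berwald_moor_cone x"
  by (auto simp: indicatrix_def)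

lemma indicatrix_iff: "y \<in> indicatrix x \<longleftrightarrow> \<bar>\<Prod>i\<in>UNIV. coords x y $ i\<bar> = 1"
proof -
  define p where "p = (\<Prod>i\<in>UNIV. coords x y $ i)"
  have cone: "y \<in> berwald_moor_cone x \<longleftrightarrow> p \<noteq> 0"
    by (simp add: cone_iff_coords p_def)
  have "(root 3 p)\<^sup>2 = 1 \<or> (root 3 p)\<^sup>2 = -1 \<longleftrightarrow> (root 3 p)\<^sup>2 = 1"
    using zero_le_power2[of "root 3 p"] by linarith
  also have "\<dots> \<longleftrightarrow> \<bar>root 3 p\<bar> = 1"
    by (rule abs_square_eq_1)
  also have "\<dots> \<longleftrightarrow> \<bar>p\<bar> = 1"
    using real_root_abs[of 3 p] real_root_eq_1_iff[of 3 "\<bar>p\<bar>"] by simp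
  finally have eq: "(root 3 p)\<^sup>2 = 1 \<or> (root 3 p)\<^sup>2 = -1 \<longleftrightarrow> \<bar>p\<bar> = 1" .
  have "y \<in> indicatrix x \<longleftrightarrow> p \<noteq> 0 \<and> ((root 3 p)\<^sup>2 = 1 \<or> (root 3 p)\<^sup>2 = -1)"
    by (simp only: indicatrix_def mem_Collect_eq cone berwald_moor_coords p_def)
  also have "\<dots> \<longleftrightarrow> \<bar>p\<bar> = 1"
    unfolding eq by auto
  finally show ?thesis by (simp only: p_def)
qed

lemma dilate_in_indicatrix:
  assumes "y \<in> indicatrix x" "\<bar>\<Prod>i\<in>UNIV. c$i\<bar> = 1"
  shows "dilate x c y \<in> indicatrix x"
  using assms by (simp add: indicatrix_iff prod.distrib abs_mult)

lemma log_sum_dilate: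
  "y \<in> berwald_moor_cone x \<Longrightarrow> log_sum x y (dilate x c y) = (\<Sum>i\<in>UNIV. c$i)"
  by (simp add: log_sum_def cone_iff_coords)

lemma has_derivative_root3_square:
  fixes p :: "'a::real_normed_vector \<Rightarrow> real"
  assumes p: "(p has_derivative D) (at z)" and nz: "p z \<noteq> 0"
  shows "((\<lambda>z. (root 3 (p z))\<^sup>2) has_derivative (\<lambda>v. 2/3 * (root 3 (p z))\<^sup>2 * (D v / p z))) (at z)"
proof -
  have "(root 3 has_derivative (*) (inverse (3 * root 3 (p z) ^ 2))) (at (p z))"
    using DERIV_odd_real_root[of 3 "p z"] nz by (simp add: has_field_derivative_def)
  from has_derivative_power[OF has_derivative_compose[OF p this], of 2]
  have "((\<lambda>z. (root 3 (p z))\<^sup>2) has_derivative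
      (\<lambda>v. 2 * (inverse (3 * root 3 (p z) ^ 2) * D v) * root 3 (p z))) (at z)"
    by simp
  moreover have "2 * (inverse (3 * root 3 (p z) ^ 2) * d) * root 3 (p z)
      = 2/3 * (root 3 (p z))\<^sup>2 * (d / p z)" for d
  proof -
    have "2 * (inverse (3 * r ^ 2) * d) * r = 2/3 * r\<^sup>2 * (d / r ^ 3)" if "r \<noteq> 0" for r :: real
      using that by (simp add: field_simps power2_eq_square power3_eq_cube)
    from this[of "root 3 (p z)"] show ?thesis
      using nz by (simp add: odd_real_root_pow mult_ac)
  qed
  ultimately show ?thesis by (simp only:)
qed

lemma has_derivative_berwald_moor:
  assumes "y \<in> berwald_moor_cone x"
  shows "(berwald_moor x has_derivative (\<lambda>v. 2/3 * berwald_moor x y * log_sum x y v)) (at y)"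
proof -
  define p where "p = (\<lambda>y. \<Prod>i\<in>UNIV. coords x y $ i)"
  have nz: "\<And>i. coords x y $ i \<noteq> 0" "p y \<noteq> 0"
    using assms by (simp_all add: cone_iff_coords p_def)
  have "(p has_derivative (\<lambda>v. \<Sum>i\<in>UNIV. coords x v $ i * (\<Prod>j\<in>UNIV - {i}. coords x y $ j))) (at y)"
    unfolding p_def
    by (intro has_derivative_prod bounded_linear_imp_has_derivative bounded_linear_coords_nth)
  from has_derivative_root3_square[OF this nz(2)]
  have "(berwald_moor x has_derivative (\<lambda>v. 2/3 * berwald_moor x y *
      ((\<Sum>i\<in>UNIV. coords x v $ i * (\<Prod>j\<in>UNIV - {i}. coords x y $ j)) / p y))) (at y)"
    by (simp only: p_def flip: berwald_moor_coords)
  moreover have "coords x v $ i * (\<Prod>j\<in>UNIV - {i}. coords x y $ j) / p y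
      = coords x v $ i / coords x y $ i" for v i
    using nz by (simp add: p_def prod.remove[of UNIV i])
  ultimately show ?thesis
    by (simp only: log_sum_def sum_divide_distrib)
qed

lemma tangent_iff:
  assumes "y \<in> indicatrix x"
  shows "frechet_derivative (berwald_moor x) (at y) v = 0 \<longleftrightarrow> log_sum x y v = 0"
proof -
  have "y \<in> berwald_moor_cone x" "berwald_moor x y \<noteq> 0"
    using assms by (auto simp: indicatrix_def)
  then show ?thesis
    by (simp flip: frechet_derivative_at[OF has_derivative_berwald_moor])
qed

section \<open>The Lie algebra of smooth vector fields on the indicatrix\<close>

text \<open>
  The orbit \<open>t \<mapsto> exp(t c) \<cdot> y\<close> of the diagonal group stays in the indicatrix and has velocity \<open>v\<close> for \<open>c\<^sub>i = v\<^sub>i / a\<^sub>i\<close>. Composing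
  \<open>f\<close> with it expresses the value of any derivative of \<open>f\<close> within the indicatrix at \<open>v\<close> as an ordinary derivative in
  one real variable, which is unique.
\<close>

lemma derivative_within_indicatrix_unique:
  fixes f :: "real^3 \<Rightarrow> 'b::real_normed_vector"
  assumes y: "y \<in> indicatrix x" and v: "log_sum x y v = 0"
    and D: "(f has_derivative D) (at y within indicatrix x)"
    and D': "(f has_derivative D') (at y within indicatrix x)"
  shows "D v = D' v"
proof -
  have nz: "coords x y $ i \<noteq> 0" for i
    using y indicatrix_subset_cone cone_iff_coords by blast
  \<comment> \<open>The traceless diagonal matrix that moves \<open>y\<close> with velocity \<open>v\<close>.\<close>
  define c where "c = (\<chi> i. coords x v $ i / coords x y $ i)"
  define \<gamma> where "\<gamma> = (\<lambda>t. dilate x (\<chi> i. exp (t * c$i)) y)"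
  have \<gamma>0: "\<gamma> 0 = y" by (simp add: \<gamma>_def)
  have v_eq: "v = dilate x c y"
    by (rule dilate_eqI[symmetric]) (simp add: c_def nz)
  have "(\<Sum>i\<in>UNIV. t * c$i) = t * log_sum x y v" for t
    by (simp add: sum_distrib_left c_def log_sum_def)
  then have "(\<Prod>i\<in>UNIV. exp (t * c$i)) = 1" for t
    using v by (simp flip: exp_sum)
  then have \<gamma>_in: "\<gamma> t \<in> indicatrix x" for t
    unfolding \<gamma>_def by (intro dilate_in_indicatrix y) simp
  have "(\<gamma> has_derivative (\<lambda>t. t *\<^sub>R v)) (at 0)"
    unfolding has_derivative_componentwise_within [of \<gamma>] Basis_vec_def v_eq
    by (auto simp: \<gamma>_def dilate_def inner_axis forall_3 algebra_simps intro!: derivative_eq_intros)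
  then have \<gamma>': "(\<gamma> has_vector_derivative v) (at 0)"
    by (simp add: has_vector_derivative_def)
  have chain: "((f \<circ> \<gamma>) has_vector_derivative E v) (at 0)"
    if "(f has_derivative E) (at y within indicatrix x)" for E
  proof -
    have "(f has_derivative E) (at (\<gamma> 0) within range \<gamma>)"
      using that \<gamma>0 \<gamma>_in by (auto intro: has_derivative_subset)
    then show ?thesis
      using vector_derivative_diff_chain_within[of \<gamma> v 0 UNIV f E] \<gamma>' by simp
  qed
  show ?thesis
    using chain[OF D] chain[OF D'] vector_derivative_unique_at by blast
qed

definition has_smooth_extension :: "real^3 \<Rightarrow> (real^3 \<Rightarrow> real^3) \<Rightarrow> (real^3 \<Rightarrow> real^3) \<Rightarrow> (real^3) set \<Rightarrow> bool" where
  "has_smooth_extension x X X' U \<longleftrightarrow> open U \<and> indicatrix x \<subseteq> U \<and> (\<forall>n. Ck_on n X' U) \<and> (\<forall>y\<in>indicatrix x. X y = X' y)"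

lemma smooth_fields_iff:
  "X \<in> smooth_fields x \<longleftrightarrow> (\<forall>y. y \<notin> indicatrix x \<longrightarrow> X y = 0) \<and>
     (\<forall>y\<in>indicatrix x. log_sum x y (X y) = 0) \<and> (\<exists>U X'. has_smooth_extension x X X' U)"
  by (auto simp: smooth_fields_def has_smooth_extension_def tangent_iff)

lemma has_smooth_extension_derivative:
  assumes "has_smooth_extension x X X' U" "y \<in> indicatrix x"
  shows "(X has_derivative frechet_derivative X' (at y)) (at y within indicatrix x)"
proof -
  have "Ck_on (Suc 0) X' U" "y \<in> U"
    using assms unfolding has_smooth_extension_def by blast+
  then have "(X' has_derivative frechet_derivative X' (at y)) (at y within indicatrix x)"
    using Ck_on_Suc_has_derivative has_derivative_at_withinI by blast
  then show ?thesis
    using assms by (auto simp: has_smooth_extension_def intro: has_derivative_transform)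
qed

text \<open>
  The bracket is defined through arbitrarily chosen derivatives within the indicatrix. On tangent vectors the choice
  is irrelevant, so any known derivatives may be used to compute it.
\<close>

lemma lie_bracket_eqI:
  assumes y: "y \<in> indicatrix x"
    and X: "log_sum x y (X y) = 0" "(X has_derivative DX) (at y within indicatrix x)"
    and Y: "log_sum x y (Y y) = 0" "(Y has_derivative DY) (at y within indicatrix x)"
  shows "lie_bracket x X Y y = DY (X y) - DX (Y y)"
proof -
  have "(X has_derivative frechet_derivative X (at y within indicatrix x)) (at y within indicatrix x)"
    "(Y has_derivative frechet_derivative Y (at y within indicatrix x)) (at y within indicatrix x)"
    using X Y frechet_derivative_works unfolding differentiable_def by blast+
  then show ?thesis
    using derivative_within_indicatrix_unique[OF y] X Y y by (metis lie_bracket_def)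
qed

text \<open>
  Differentiating the identity \<open>\<Sum>\<^sub>i Z\<^sub>i / a\<^sub>i = 0\<close> along a tangent vector \<open>w\<close> gives
  \<open>\<Sum>\<^sub>i (DZ w)\<^sub>i / a\<^sub>i = \<Sum>\<^sub>i Z\<^sub>i w\<^sub>i / a\<^sub>i\<^sup>2\<close>. For \<open>Z = Y\<close>, \<open>w = X\<close> and for \<open>Z = X\<close>, \<open>w = Y\<close> the right-hand side is the same.
\<close>

lemma lie_bracket_tangent:
  assumes y: "y \<in> indicatrix x"
    and X: "\<And>z. z \<in> indicatrix x \<Longrightarrow> log_sum x z (X z) = 0" "(X has_derivative DX) (at y within indicatrix x)"
    and Y: "\<And>z. z \<in> indicatrix x \<Longrightarrow> log_sum x z (Y z) = 0" "(Y has_derivative DY) (at y within indicatrix x)"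
  shows "log_sum x y (DY (X y) - DX (Y y)) = 0"
proof -
  have nz: "coords x y $ i \<noteq> 0" for i
    using y indicatrix_subset_cone cone_iff_coords by blast
  have key: "log_sum x y (DZ w) = (\<Sum>i\<in>UNIV. coords x (Z y) $ i * coords x w $ i / (coords x y $ i)\<^sup>2)"
    if Z: "\<And>z. z \<in> indicatrix x \<Longrightarrow> log_sum x z (Z z) = 0"
      and DZ: "(Z has_derivative DZ) (at y within indicatrix x)"
      and w: "log_sum x y w = 0" for Z DZ w
  proof -
    have "((\<lambda>z. coords x (Z z) $ i / coords x z $ i) has_derivative
        (\<lambda>w. (coords x (DZ w) $ i * coords x y $ i - coords x (Z y) $ i * coords x w $ i)
           / (coords x y $ i * coords x y $ i))) (at y within indicatrix x)" for i
      by (rule has_derivative_divide'[OF bounded_linear.has_derivative[OF bounded_linear_coords_nth DZ]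
          bounded_linear.has_derivative[OF bounded_linear_coords_nth has_derivative_ident] nz])
    then have "((\<lambda>z. log_sum x z (Z z)) has_derivative
        (\<lambda>w. \<Sum>i\<in>UNIV. (coords x (DZ w) $ i * coords x y $ i - coords x (Z y) $ i * coords x w $ i)
           / (coords x y $ i * coords x y $ i))) (at y within indicatrix x)"
      unfolding log_sum_def by (rule has_derivative_sum)
    moreover have "((\<lambda>z. log_sum x z (Z z)) has_derivative (\<lambda>w. 0)) (at y within indicatrix x)"
      by (rule has_derivative_transform[OF y _ has_derivative_const[of 0]]) (simp add: Z)
    ultimately have "(\<Sum>i\<in>UNIV. (coords x (DZ w) $ i * coords x y $ i
        - coords x (Z y) $ i * coords x w $ i) / (coords x y $ i * coords x y $ i)) = 0"
      using derivative_within_indicatrix_unique[OF y w] by blast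
    then show ?thesis
      by (simp add: log_sum_def sum_subtractf diff_divide_distrib power2_eq_square nz)
  qed
  have "log_sum x y (DY (X y)) = log_sum x y (DX (Y y))"
    using key[OF Y X(1)[OF y]] key[OF X Y(1)[OF y]] by (simp add: mult_ac)
  moreover have "log_sum x y (a - b) = log_sum x y a - log_sum x y b" for a b
    by (simp add: log_sum_def sum_subtractf diff_divide_distrib coords_diff)
  ultimately show ?thesis by simp
qed

lemma lie_bracket_in_smooth_fields:
  assumes "X \<in> smooth_fields x" "Y \<in> smooth_fields x"
  shows "lie_bracket x X Y \<in> smooth_fields x"
proof -
  obtain U X' V Y' where X': "has_smooth_extension x X X' U" and Y': "has_smooth_extension x Y Y' V"
    using assms by (auto simp: smooth_fields_iff)
  have X: "\<And>z. z \<in> indicatrix x \<Longrightarrow> log_sum x z (X z) = 0"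
    and Y: "\<And>z. z \<in> indicatrix x \<Longrightarrow> log_sum x z (Y z) = 0"
    using assms by (auto simp: smooth_fields_iff)
  note DX = has_smooth_extension_derivative[OF X'] and DY = has_smooth_extension_derivative[OF Y']
  have eq: "lie_bracket x X Y y = frechet_derivative Y' (at y) (X y) - frechet_derivative X' (at y) (Y y)"
    if "y \<in> indicatrix x" for y
    by (intro lie_bracket_eqI X Y DX DY that)
  let ?W = "U \<inter> V"
  let ?Z = "\<lambda>y. frechet_derivative Y' (at y) (X' y) + (-1) *\<^sub>R frechet_derivative X' (at y) (Y' y)"
  have W: "open ?W" and C: "Ck_on n X' ?W" "Ck_on n Y' ?W" for n
    using X' Y' by (auto simp: has_smooth_extension_def intro: Ck_on_subset)
  have "has_smooth_extension x (lie_bracket x X Y) ?Z ?W"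
    unfolding has_smooth_extension_def
  proof (intro conjI allI ballI)
    show "Ck_on n ?Z ?W" for n
      by (intro Ck_on_add Ck_on_scaleR Ck_on_frechet_derivative W C)
  qed (use X' Y' W eq in \<open>auto simp: has_smooth_extension_def\<close>)
  moreover have "log_sum x y (lie_bracket x X Y y) = 0" if "y \<in> indicatrix x" for y
    unfolding eq[OF that] by (intro lie_bracket_tangent X Y DX DY that)
  ultimately show ?thesis
    unfolding smooth_fields_iff by (auto simp: lie_bracket_def)
qed

lemma log_sum_add: "log_sum x y (a + b) = log_sum x y a + log_sum x y b"
  by (simp add: log_sum_def sum.distrib add_divide_distrib coords_add)

lemma log_sum_scaleR: "log_sum x y (c *\<^sub>R a) = c * log_sum x y a"
  by (simp add: log_sum_def sum_distrib_left coords_scaleR)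

lemma has_smooth_extension_add:
  assumes "has_smooth_extension x X X' U" "has_smooth_extension x Y Y' V"
  shows "has_smooth_extension x (X + Y) (\<lambda>y. X' y + Y' y) (U \<inter> V)"
  using assms unfolding has_smooth_extension_def
  by (auto intro!: Ck_on_add intro: Ck_on_subset)

lemma subspace_smooth_fields: "vfield.subspace (smooth_fields x)"
proof (rule vfield.subspaceI)
  have "has_smooth_extension x 0 (\<lambda>y. 0) UNIV"
    by (auto simp: has_smooth_extension_def Ck_on_const)
  then show "0 \<in> smooth_fields x"
    unfolding smooth_fields_iff using log_sum_scaleR[of x _ 0] by auto
  show "X + Y \<in> smooth_fields x" if "X \<in> smooth_fields x" "Y \<in> smooth_fields x" for X Y
    using that has_smooth_extension_add unfolding smooth_fields_iff
    by (fastforce simp: log_sum_add)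
  show "scale_field c X \<in> smooth_fields x" if X: "X \<in> smooth_fields x" for c X
  proof -
    obtain X' U where "has_smooth_extension x X X' U"
      using X by (auto simp: smooth_fields_iff)
    then have "has_smooth_extension x (scale_field c X) (\<lambda>y. c *\<^sub>R X' y) U"
      by (auto simp: has_smooth_extension_def scale_field_def Ck_on_scaleR)
    then show ?thesis
      using X unfolding smooth_fields_iff by (auto simp: scale_field_def log_sum_scaleR)
  qed
qed

lemma lie_subalgebra_smooth_fields: "lie_subalgebra x (smooth_fields x)"
  by (simp add: lie_subalgebra_def subspace_smooth_fields lie_bracket_in_smooth_fields)

text \<open>
  Lie subalgebras are stable under intersections of nonempty families; the algebra of all smooth fields shows that
  the family of subalgebras containing \<open>G\<close> is not empty.
\<close>

lemma lie_subalgebra_hull: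
  assumes "G \<subseteq> smooth_fields x"
  shows "lie_subalgebra x (lie_subalgebra x hull G)"
  using hull_minimal[of G "smooth_fields x" "lie_subalgebra x", OF assms lie_subalgebra_smooth_fields]
  unfolding lie_subalgebra_def hull_def vfield.subspace_def by blast

section \<open>Monomial fields\<close>

definition monomial :: "real^3 \<Rightarrow> int^3 \<Rightarrow> real^3 \<Rightarrow> real" where
  "monomial x m y = (\<Prod>i\<in>UNIV. coords x y $ i powi (m$i))"

definition monomial_field :: "real^3 \<Rightarrow> int^3 \<Rightarrow> real^3 \<Rightarrow> real^3 \<Rightarrow> real^3" where
  "monomial_field x m c = (\<lambda>y. if y \<in> indicatrix x then monomial x m y *\<^sub>R dilate x c y else 0)"

text \<open>
  The eigenvalue of the derivation along the linear field with coefficients \<open>c\<close> on the Laurent monomial with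
  exponent \<open>m\<close>.
\<close>

definition weight :: "int^3 \<Rightarrow> real^3 \<Rightarrow> real" where
  "weight m c = (\<Sum>i\<in>UNIV. of_int (m$i) * c$i)"

lemma has_derivative_monomial:
  assumes "y \<in> berwald_moor_cone x"
  shows "(monomial x m has_derivative
    (\<lambda>v. monomial x m y * (\<Sum>i\<in>UNIV. of_int (m$i) * (coords x v $ i / coords x y $ i)))) (at y)"
proof -
  have nz: "coords x y $ i \<noteq> 0" for i
    using assms by (simp add: cone_iff_coords)
  have "((\<lambda>z. coords x z $ i powi (m$i)) has_derivative
      (\<lambda>v. coords x v $ i * (of_int (m$i) * coords x y $ i powi (m$i - 1)))) (at y)" for i
    by (intro has_derivative_power_int nz bounded_linear_imp_has_derivative bounded_linear_coords_nth)
  then have "(monomial x m has_derivative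
      (\<lambda>v. \<Sum>i\<in>UNIV. coords x v $ i * (of_int (m$i) * coords x y $ i powi (m$i - 1))
        * (\<Prod>j\<in>UNIV - {i}. coords x y $ j powi (m$j)))) (at y)"
    unfolding monomial_def by (rule has_derivative_prod)
  moreover have "coords x v $ i * (of_int (m$i) * coords x y $ i powi (m$i - 1))
        * (\<Prod>j\<in>UNIV - {i}. coords x y $ j powi (m$j))
      = monomial x m y * (of_int (m$i) * (coords x v $ i / coords x y $ i))" for v i
    using nz[of i] by (simp add: monomial_def prod.remove[of UNIV i] power_int_diff)
  ultimately show ?thesis
    by (simp only: sum_distrib_left)
qed

lemma has_derivative_monomial_field:
  assumes "y \<in> indicatrix x"
  shows "(monomial_field x m c has_derivative
    (\<lambda>v. monomial x m y *\<^sub>R dilate x c v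
      + (monomial x m y * (\<Sum>i\<in>UNIV. of_int (m$i) * (coords x v $ i / coords x y $ i))) *\<^sub>R dilate x c y))
    (at y within indicatrix x)"
proof (rule has_derivative_transform[OF assms])
  show "((\<lambda>y. monomial x m y *\<^sub>R dilate x c y) has_derivative
    (\<lambda>v. monomial x m y *\<^sub>R dilate x c v
      + (monomial x m y * (\<Sum>i\<in>UNIV. of_int (m$i) * (coords x v $ i / coords x y $ i))) *\<^sub>R dilate x c y))
    (at y within indicatrix x)"
    using assms indicatrix_subset_cone
    by (intro has_derivative_scaleR has_derivative_monomial[THEN has_derivative_at_withinI]
        bounded_linear_imp_has_derivative bounded_linear_dilate) auto
qed (simp add: monomial_field_def)

lemma log_sum_monomial_field:
  assumes "y \<in> indicatrix x" "(\<Sum>i\<in>UNIV. c$i) = 0"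
  shows "log_sum x y (monomial_field x m c y) = 0"
  using assms subsetD[OF indicatrix_subset_cone assms(1)]
  by (simp add: monomial_field_def log_sum_scaleR log_sum_dilate)

lemma monomial_add:
  "y \<in> berwald_moor_cone x \<Longrightarrow> monomial x (m + n) y = monomial x m y * monomial x n y"
  by (simp add: monomial_def power_int_add cone_iff_coords prod.distrib)

text \<open>
  The linear fields are simultaneously diagonal and so commute. What remains of the bracket are the derivatives of
  the two monomials, which are eigenvectors of these fields.
\<close>

lemma lie_bracket_monomial_field:
  assumes "(\<Sum>i\<in>UNIV. c$i) = 0" "(\<Sum>i\<in>UNIV. d$i) = 0"
  shows "lie_bracket x (monomial_field x m c) (monomial_field x n d)
    = monomial_field x (m + n) (weight n c *\<^sub>R d - weight m d *\<^sub>R c)"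
proof
  fix y
  show "lie_bracket x (monomial_field x m c) (monomial_field x n d) y
    = monomial_field x (m + n) (weight n c *\<^sub>R d - weight m d *\<^sub>R c) y"
  proof (cases "y \<in> indicatrix x")
    case y: True
    then have cone: "y \<in> berwald_moor_cone x" and nz: "\<And>i. coords x y $ i \<noteq> 0"
      using indicatrix_subset_cone cone_iff_coords by blast+
    define M N where "M = monomial x m y" and "N = monomial x n y"
    have w: "(\<Sum>i\<in>UNIV. of_int (k$i) * (coords x (t *\<^sub>R dilate x e y) $ i / coords x y $ i)) = t * weight k e"
      for k e and t :: real
      by (simp add: weight_def sum_distrib_left nz mult_ac coords_scaleR)
    have "lie_bracket x (monomial_field x m c) (monomial_field x n d) y
      = (N *\<^sub>R dilate x d (M *\<^sub>R dilate x c y) + (N * (M * weight n c)) *\<^sub>R dilate x d y)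
        - (M *\<^sub>R dilate x c (N *\<^sub>R dilate x d y) + (M * (N * weight m d)) *\<^sub>R dilate x c y)"
      unfolding lie_bracket_eqI[OF y log_sum_monomial_field[OF y assms(1)]
            has_derivative_monomial_field[OF y] log_sum_monomial_field[OF y assms(2)]
            has_derivative_monomial_field[OF y]]
      using y by (simp add: monomial_field_def w M_def N_def del: times_divide_eq_right)
    also have "\<dots> = (M * N) *\<^sub>R dilate x (weight n c *\<^sub>R d - weight m d *\<^sub>R c) y"
      by (simp add: dilate_def vec_eq_iff forall_3 algebra_simps)
    finally show ?thesis
      using y by (simp add: monomial_field_def monomial_add[OF cone] M_def N_def)
  qed (simp add: lie_bracket_def monomial_field_def)
qed

lemma monomial_field_in_smooth_fields:
  assumes "(\<Sum>i\<in>UNIV. c$i) = 0"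
  shows "monomial_field x m c \<in> smooth_fields x"
proof -
  have "Ck_on n (\<lambda>y. coords x y $ 1 powi (m$1) *\<^sub>R coords x y $ 2 powi (m$2)
      *\<^sub>R coords x y $ 3 powi (m$3) *\<^sub>R dilate x c y) (berwald_moor_cone x)" for n
    by (intro Ck_on_power_int_nth open_berwald_moor_cone Ck_on_linear bounded_linear_coords
        bounded_linear_dilate) (auto simp: cone_iff_coords simp del: coords_nth)
  then have "has_smooth_extension x (monomial_field x m c) (\<lambda>y. coords x y $ 1 powi (m$1)
      *\<^sub>R coords x y $ 2 powi (m$2) *\<^sub>R coords x y $ 3 powi (m$3) *\<^sub>R dilate x c y) (berwald_moor_cone x)"
    unfolding has_smooth_extension_def
    by (auto simp: open_berwald_moor_cone indicatrix_subset_cone monomial_field_def monomial_def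
        prod_UNIV_3 mult.assoc simp del: coords_nth)
  then show ?thesis
    using assms unfolding smooth_fields_iff
    by (auto simp: log_sum_monomial_field) (simp add: monomial_field_def)
qed

section \<open>An infinite-dimensional subalgebra\<close>

text \<open>
  The coefficient vectors of the iterated brackets. With \<open>m = (1,-2,1)\<close>, \<open>c = (1,0,-1)\<close> and \<open>d = (-5/4,1/4,1)\<close> the
  recursion \<open>d \<mapsto> -d - (m \<cdot> d) c\<close> reverses the sign of \<open>m \<cdot> d = -3/4\<close> in each step, and has the closed form
  \<open>(-1)\<^sup>k (d - 3/4 k c)\<close>.
\<close>

definition ladder_coeff :: "nat \<Rightarrow> real^3" where
  "ladder_coeff k = (-1)^k *\<^sub>R vector [-5/4 - 3/4 * real k, 1/4, 1 + 3/4 * real k]"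

lemma lie_bracket_ladder:
  "lie_bracket x (monomial_field x (vector [1,-2,1]) (vector [1,0,-1]))
     (monomial_field x (vector [1 + int k, -3 - 2 * int k, 2 + int k]) (ladder_coeff k))
   = monomial_field x (vector [1 + int (Suc k), -3 - 2 * int (Suc k), 2 + int (Suc k)]) (ladder_coeff (Suc k))"
proof -
  let ?m = "vector [1,-2,1] :: int^3" and ?c = "vector [1,0,-1] :: real^3"
  let ?n = "vector [1 + int k, -3 - 2 * int k, 2 + int k] :: int^3"
  have 1: "?m + ?n = vector [1 + int (Suc k), -3 - 2 * int (Suc k), 2 + int (Suc k)]"
    by (simp add: vec_eq_iff forall_3)
  have 2: "weight ?n ?c *\<^sub>R ladder_coeff k - weight ?m (ladder_coeff k) *\<^sub>R ?c = ladder_coeff (Suc k)"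
    by (simp add: vec_eq_iff forall_3 weight_def sum_3 ladder_coeff_def field_simps)
  have "(\<Sum>i\<in>UNIV. ?c $ i) = 0" "(\<Sum>i\<in>UNIV. ladder_coeff k $ i) = 0"
    by (simp_all add: sum_3 ladder_coeff_def field_simps)
  from lie_bracket_monomial_field[OF this] show ?thesis
    by (simp only: 1 2)
qed

text \<open>
  Along the curve with frame coordinates \<open>(s, 1/s, 1)\<close> the second frame component of the \<open>k\<close>-th field is
  \<open>\<plusminus>1/4 s\<^sup>3 (s\<^sup>3)\<^sup>k\<close>. A linear relation between the fields would be a polynomial vanishing at all positive reals.
\<close>

lemma infinite_dimensional_ladder:
  assumes "\<And>k. monomial_field x (vector [1 + int k, -3 - 2 * int k, 2 + int k]) (ladder_coeff k) \<in> S"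
  shows "infinite_dimensional S"
  unfolding infinite_dimensional_def
proof
  define Z where "Z = (\<lambda>k. monomial_field x (vector [1 + int k, -3 - 2 * int k, 2 + int k]) (ladder_coeff k))"
  \<comment> \<open>The curve whose frame coordinates are \<open>(s, 1/s, 1)\<close>.\<close>
  define p where "p = (\<lambda>s::real. vector [s, inverse s + x$1, 1] :: real^3)"
  have Z_p: "coords x (Z k (p s)) $ 2 = (-1)^k / 4 * s^3 * (s^3) ^ k" if "s > 0" for k s
  proof -
    have c: "coords x (p s) = vector [s, inverse s, 1]"
      by (simp add: p_def vec_eq_iff forall_3)
    have I: "p s \<in> indicatrix x"
      unfolding indicatrix_iff c prod_UNIV_3 using that by simp
    have "coords x (Z k (p s)) $ 2 = monomial x (vector [1 + int k, -3 - 2 * int k, 2 + int k]) (p s)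
        * coords x (dilate x (ladder_coeff k) (p s)) $ 2"
      using I by (simp add: Z_def monomial_field_def coords_scaleR del: coords_nth coords_dilate)
    also have "\<dots> = s powi (1 + int k) * inverse s powi (-3 - 2 * int k) * ((-1)^k / 4 * inverse s)"
      unfolding monomial_def prod_UNIV_3 coords_dilate c by (simp add: ladder_coeff_def)
    also have "s powi (1 + int k) = s ^ (1 + k)"
      using power_int_of_nat[of s "1 + k"] by simp
    also have "inverse s powi (-3 - 2 * int k) = s ^ (3 + 2 * k)"
    proof -
      have "-3 - 2 * int k = - int (3 + 2 * k)" by simp
      then show ?thesis by (simp only: power_int_minus power_int_of_nat) (simp add: power_inverse)
    qed
    also have "s ^ (1 + k) * s ^ (3 + 2 * k) * ((-1)^k / 4 * inverse s) = (-1)^k / 4 * s^3 * (s^3) ^ k"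
      using that by (simp add: power_add power_mult power3_eq_cube power2_eq_square power_mult_distrib)
    finally show ?thesis .
  qed
  have inj: "inj Z"
  proof (rule injI)
    fix j k assume "Z j = Z k"
    then have "\<bar>(-1)^j / 4 * 2^3 * (2^3 :: real) ^ j\<bar> = \<bar>(-1)^k / 4 * 2^3 * (2^3) ^ k\<bar>"
      using Z_p[of 2 j] Z_p[of 2 k] by simp
    then show "j = k" by (simp add: abs_mult power_abs)
  qed
  have indep: "vfield.independent (range Z)"
    unfolding vfield.independent_explicit_module
  proof (intro allI impI)
    fix t u v
    assume t: "finite t" "t \<subseteq> range Z" and 0: "(\<Sum>v\<in>t. scale_field (u v) v) = 0" and v: "v \<in> t"
    define K where "K = Z -` t"
    have K: "finite K" "t = Z ` K"
      using t inj by (auto simp: K_def finite_vimageI)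
    define P where "P = (\<Sum>k\<in>K. Polynomial.monom (u (Z k) * (-1)^k) k)"
    have root: "poly P (s^3) = 0" if "s > 0" for s
    proof -
      have "0 = coords x ((\<Sum>k\<in>K. scale_field (u (Z k)) (Z k)) (p s)) $ 2"
        using 0 by (simp add: K(2) sum.reindex[OF inj_on_subset[OF inj]])
      also have "\<dots> = (\<Sum>k\<in>K. u (Z k) * coords x (Z k (p s)) $ 2)"
        using K(1) by (induction rule: finite_induct)
          (simp_all add: scale_field_def coords_add coords_scaleR del: coords_nth, simp)
      also have "\<dots> = s^3 / 4 * poly P (s^3)"
        by (simp only: Z_p[OF that]) (simp add: P_def poly_sum poly_monom sum_distrib_left mult_ac)
      finally show ?thesis using that by simp
    qed
    have "{0<..} \<subseteq> {z. poly P z = 0}"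
    proof
      fix z :: real assume "z \<in> {0<..}"
      then show "z \<in> {z. poly P z = 0}"
        using root[of "root 3 z"] by simp
    qed
    then have "P = 0"
      using poly_roots_finite[of P] infinite_Ioi[of "0::real"] finite_subset by blast
    obtain k where k: "k \<in> K" "v = Z k"
      using v K by blast
    have "coeff P k = u (Z k) * (-1)^k"
      using K(1) k(1) by (simp add: P_def coeff_sum)
    then show "u v = 0"
      using \<open>P = 0\<close> k by simp
  qed
  assume "\<exists>B. finite B \<and> S \<subseteq> vfield.span B"
  then obtain B where B: "finite B" "S \<subseteq> vfield.span B" by blast
  have "finite (range Z)"
    using vfield.independent_span_bound[OF B(1) indep] B(2) assms by (auto simp: Z_def)
  then show False
    using inj finite_imageD by blast
qed

section \<open>The metric tensor, the spray and the curvature\<close>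

lemma open_cone_bundle: "open {p. snd p \<in> berwald_moor_cone (fst p)}"
  unfolding berwald_moor_cone_def mem_Collect_eq
  by (intro open_Collect_neq continuous_on_mult continuous_on_diff continuous_on_component
      continuous_on_fst continuous_on_snd continuous_on_id continuous_on_const)

text \<open>
  All objects built from the metric are known by formulas on the cone bundle only. The bundle is open in the product,
  so one derivative of such a formula in both variables jointly yields all partial derivatives.
\<close>

lemma partials_eqI:
  assumes y: "y \<in> berwald_moor_cone x"
    and eq: "\<And>x y. y \<in> berwald_moor_cone x \<Longrightarrow> f x y = g x y"
    and D: "((\<lambda>p. g (fst p) (snd p)) has_derivative D) (at (x, y))"
  shows "partial_y k f x y = D (0, axis k 1)" "partial_x k f x y = D (axis k 1, 0)"
proof -
  have f: "((\<lambda>p. f (fst p) (snd p)) has_derivative D) (at (x, y))"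
    by (rule has_derivative_transform_within_open[OF D open_cone_bundle]) (use y in \<open>simp_all add: eq\<close>)
  have *: "deriv (\<lambda>t. f (fst (l t)) (snd (l t))) 0 = D h"
    if l: "(l has_derivative (\<lambda>t. t *\<^sub>R h)) (at 0)" and "l 0 = (x, y)" for l h
  proof -
    have "((\<lambda>t. f (fst (l t)) (snd (l t))) has_derivative (\<lambda>t. D (t *\<^sub>R h))) (at 0)"
      using has_derivative_compose[OF l, of "\<lambda>p. f (fst p) (snd p)" D] f that(2) by simp
    moreover have "D (t *\<^sub>R h) = D h * t" for t
      using linear_scale[OF has_derivative_linear[OF D]] by simp
    ultimately show ?thesis
      by (simp add: DERIV_imp_deriv has_field_derivative_def)
  qed
  have "((\<lambda>t. (x, y + t *\<^sub>R axis k 1)) has_derivative (\<lambda>t. t *\<^sub>R (0, axis k 1))) (at 0)"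
    by (auto intro!: derivative_eq_intros)
  from *[OF this] show "partial_y k f x y = D (0, axis k 1)"
    by (simp add: partial_y_def)
  have "((\<lambda>t. (x + t *\<^sub>R axis k 1, y)) has_derivative (\<lambda>t. t *\<^sub>R (axis k 1, 0))) (at 0)"
    by (auto intro!: derivative_eq_intros)
  from *[OF this] show "partial_x k f x y = D (axis k 1, 0)"
    by (simp add: partial_x_def)
qed

text \<open>
  The inverse of the second frame coordinate. With it the spray and the connection become polynomials in
  \<open>x\<^sup>1, y\<^sup>1, y\<^sup>3\<close> and this single quantity.
\<close>

definition inv2 :: "real^3 \<Rightarrow> real^3 \<Rightarrow> real" where
  "inv2 x y = inverse (y$2 - x$1 * y$3)"

definition d_inv2 :: "real^3 \<Rightarrow> real^3 \<Rightarrow> (real^3) \<times> (real^3) \<Rightarrow> real" where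
  "d_inv2 x y h = - (inv2 x y)\<^sup>2 * (snd h $ 2 - fst h $ 1 * y$3 - x$1 * snd h $ 3)"

lemmas has_derivative_fst_nth = bounded_linear.has_derivative[OF bounded_linear_vec_nth has_derivative_fst]
  and has_derivative_snd_nth = bounded_linear.has_derivative[OF bounded_linear_vec_nth has_derivative_snd]

lemma has_derivative_inv2:
  assumes "y \<in> berwald_moor_cone x"
  shows "((\<lambda>p. inv2 (fst p) (snd p)) has_derivative d_inv2 x y) (at (x, y))"
proof -
  have "y$2 - x$1 * y$3 \<noteq> 0"
    using assms by (simp add: berwald_moor_cone_def)
  then show ?thesis
    unfolding inv2_def
    by (auto intro!: derivative_eq_intros has_derivative_fst_nth has_derivative_snd_nth
        simp: d_inv2_def inv2_def fun_eq_iff power2_eq_square algebra_simps)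
qed

text \<open>
  Gradient and Hessian in \<open>y\<close> of \<open>l = log \<bar>a\<^sup>1 a\<^sup>2 a\<^sup>3\<bar>\<close>, and their derivatives with respect to \<open>x\<^sup>1\<close>, the only
  component of \<open>x\<close> on which \<open>l\<close> depends. Since \<open>log F = 2/3 l\<close>, every derivative of the metric function \<open>F\<close>
  is \<open>F\<close> times a polynomial in derivatives of \<open>l\<close>.
\<close>

definition log_gradient :: "real^3 \<Rightarrow> real^3 \<Rightarrow> real^3" where
  "log_gradient x y = vector [inverse (y$1), inv2 x y, inverse (y$3) - x$1 * inv2 x y]"

definition log_hessian :: "real^3 \<Rightarrow> real^3 \<Rightarrow> real^3^3" where
  "log_hessian x y = vector [
     vector [- (inverse (y$1) ^ 2), 0, 0],
     vector [0, - (inv2 x y ^ 2), x$1 * inv2 x y ^ 2],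
     vector [0, x$1 * inv2 x y ^ 2, - (inverse (y$3) ^ 2) - x$1 ^ 2 * inv2 x y ^ 2]]"

definition log_gradient_dx :: "real^3 \<Rightarrow> real^3 \<Rightarrow> real^3" where
  "log_gradient_dx x y = vector [0, y$3 * inv2 x y ^ 2, - inv2 x y - x$1 * y$3 * inv2 x y ^ 2]"

definition log_hessian_dx :: "real^3 \<Rightarrow> real^3 \<Rightarrow> real^3^3" where
  "log_hessian_dx x y = vector [
     vector [0, 0, 0],
     vector [0, - 2 * y$3 * inv2 x y ^ 3, inv2 x y ^ 2 + 2 * x$1 * y$3 * inv2 x y ^ 3],
     vector [0, inv2 x y ^ 2 + 2 * x$1 * y$3 * inv2 x y ^ 3,
       - 2 * x$1 * inv2 x y ^ 2 - 2 * x$1 ^ 2 * y$3 * inv2 x y ^ 3]]"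

lemma has_derivative_berwald_moor_bundle:
  assumes "y \<in> berwald_moor_cone x"
  shows "((\<lambda>p. berwald_moor (fst p) (snd p)) has_derivative
    (\<lambda>h. 2/3 * berwald_moor x y * ((\<Sum>i\<in>UNIV. log_gradient x y $ i * snd h $ i) - y$3 * inv2 x y * fst h $ 1)))
    (at (x, y))"
proof -
  have nz: "y$1 \<noteq> 0" "y$2 - x$1 * y$3 \<noteq> 0" "y$3 \<noteq> 0"
    using assms by (auto simp: berwald_moor_cone_def)
  have "((\<lambda>p. snd p $ 1 * (snd p $ 2 - fst p $ 1 * snd p $ 3) * snd p $ 3) has_derivative
      (\<lambda>h. snd h $ 1 * (y$2 - x$1 * y$3) * y$3
        + y$1 * (snd h $ 2 - fst h $ 1 * y$3 - x$1 * snd h $ 3) * y$3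
        + y$1 * (y$2 - x$1 * y$3) * snd h $ 3)) (at (x, y))"
    by (auto intro!: derivative_eq_intros has_derivative_fst_nth has_derivative_snd_nth
        simp: fun_eq_iff algebra_simps)
  from has_derivative_root3_square[OF this]
  have "((\<lambda>p. berwald_moor (fst p) (snd p)) has_derivative
      (\<lambda>h. 2/3 * berwald_moor x y * ((snd h $ 1 * (y$2 - x$1 * y$3) * y$3
        + y$1 * (snd h $ 2 - fst h $ 1 * y$3 - x$1 * snd h $ 3) * y$3
        + y$1 * (y$2 - x$1 * y$3) * snd h $ 3) / (y$1 * (y$2 - x$1 * y$3) * y$3)))) (at (x, y))"
    using nz by (simp add: berwald_moor_def)
  moreover have "(snd h $ 1 * (y$2 - x$1 * y$3) * y$3
        + y$1 * (snd h $ 2 - fst h $ 1 * y$3 - x$1 * snd h $ 3) * y$3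
        + y$1 * (y$2 - x$1 * y$3) * snd h $ 3) / (y$1 * (y$2 - x$1 * y$3) * y$3)
     = (\<Sum>i\<in>UNIV. log_gradient x y $ i * snd h $ i) - y$3 * inv2 x y * fst h $ 1" for h :: "(real^3) \<times> (real^3)"
  proof -
    define a where "a = y$2 - x$1 * y$3"
    have inv2: "inv2 x y = 1 / a" and "a \<noteq> 0"
      using nz by (auto simp: inv2_def a_def divide_inverse)
    then show ?thesis
      using nz by (simp add: inv2 log_gradient_def sum_3 field_simps flip: a_def)
  qed
  ultimately show ?thesis by (simp only:)
qed

lemma partial_y_berwald_moor:
  assumes "y \<in> berwald_moor_cone x"
  shows "partial_y i berwald_moor x y = 2/3 * berwald_moor x y * log_gradient x y $ i"
  using partials_eqI(1)[OF assms refl has_derivative_berwald_moor_bundle[OF assms], of i]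
  by (simp add: axis_def if_distrib cong: if_cong)

lemma has_derivative_log_gradient:
  assumes "y \<in> berwald_moor_cone x"
  shows "((\<lambda>p. log_gradient (fst p) (snd p) $ j) has_derivative
    (\<lambda>h. (\<Sum>i\<in>UNIV. log_hessian x y $ j $ i * snd h $ i) + log_gradient_dx x y $ j * fst h $ 1)) (at (x, y))"
proof -
  have nz: "y$1 \<noteq> 0" "y$3 \<noteq> 0"
    using assms by (auto simp: berwald_moor_cone_def)
  note intros = derivative_eq_intros has_derivative_inv2[OF assms] has_derivative_fst_nth has_derivative_snd_nth
  have 1: "((\<lambda>p. inverse (snd p $ 1)) has_derivative (\<lambda>h. - (inverse (y$1) ^ 2) * snd h $ 1)) (at (x, y))"
    and 3: "((\<lambda>p. inverse (snd p $ 3) - fst p $ 1 * inv2 (fst p) (snd p)) has_derivative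
      (\<lambda>h. - (inverse (y$3) ^ 2) * snd h $ 3 - (fst h $ 1 * inv2 x y + x$1 * d_inv2 x y h))) (at (x, y))"
    using nz by (auto intro!: intros simp: fun_eq_iff power2_eq_square)
  show ?thesis
    using exhaust_3[of j] 1 3 has_derivative_inv2[OF assms]
    by (auto simp: log_gradient_def log_hessian_def log_gradient_dx_def sum_3 d_inv2_def[abs_def]
        algebra_simps power2_eq_square)
qed

lemma metric_tensor_cone:
  assumes "y \<in> berwald_moor_cone x"
  shows "metric_tensor i j x y = berwald_moor x y *
    (2/9 * (log_gradient x y $ i * log_gradient x y $ j) + 1/3 * log_hessian x y $ j $ i)"
proof -
  have "partial_y i (partial_y j berwald_moor) x y
    = 2/3 * (berwald_moor x y * log_hessian x y $ j $ i
        + 2/3 * berwald_moor x y * log_gradient x y $ i * log_gradient x y $ j)"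
    by (subst partials_eqI(1)[OF assms partial_y_berwald_moor])
      (auto intro!: derivative_eq_intros has_derivative_berwald_moor_bundle[OF assms]
        has_derivative_log_gradient[OF assms] simp: axis_def if_distrib cong: if_cong)
  then show ?thesis
    by (simp add: metric_tensor_def algebra_simps)
qed

text \<open>
  The spray contains derivatives of the metric tensor in the base directions only, so the fibre part of this
  differential is left unspecified.
\<close>

lemma has_derivative_log_hessian_dx:
  assumes "y \<in> berwald_moor_cone x"
  obtains D where "((\<lambda>p. log_hessian (fst p) (snd p) $ j $ i) has_derivative D) (at (x, y))"
    "\<And>u. D (u, 0) = log_hessian_dx x y $ j $ i * u $ 1"
proof -
  have nz: "y$1 \<noteq> 0" "y$3 \<noteq> 0"
    using assms by (auto simp: berwald_moor_cone_def)
  note intros = derivative_eq_intros has_derivative_inv2[OF assms] has_derivative_fst_nth has_derivative_snd_nth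
  have 11: "((\<lambda>p. - (inverse (snd p $ 1) ^ 2)) has_derivative
      (\<lambda>h. 2 * inverse (y$1) ^ 3 * snd h $ 1)) (at (x, y))"
    and 22: "((\<lambda>p. - (inv2 (fst p) (snd p) ^ 2)) has_derivative
      (\<lambda>h. - 2 * inv2 x y * d_inv2 x y h)) (at (x, y))"
    and 23: "((\<lambda>p. fst p $ 1 * inv2 (fst p) (snd p) ^ 2) has_derivative
      (\<lambda>h. fst h $ 1 * inv2 x y ^ 2 + x$1 * (2 * inv2 x y * d_inv2 x y h))) (at (x, y))"
    and 33: "((\<lambda>p. - (inverse (snd p $ 3) ^ 2) - fst p $ 1 ^ 2 * inv2 (fst p) (snd p) ^ 2) has_derivative
      (\<lambda>h. 2 * inverse (y$3) ^ 3 * snd h $ 3 - (2 * x$1 * fst h $ 1 * inv2 x y ^ 2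
        + x$1 ^ 2 * (2 * inv2 x y * d_inv2 x y h)))) (at (x, y))"
    using nz by (auto intro!: intros simp: fun_eq_iff power2_eq_square power3_eq_cube algebra_simps)
  have "\<exists>D. ((\<lambda>p. log_hessian (fst p) (snd p) $ j $ i) has_derivative D) (at (x, y))
    \<and> (\<forall>u. D (u, 0) = log_hessian_dx x y $ j $ i * u $ 1)"
    using exhaust_3[of i] exhaust_3[of j]
    by (elim disjE) (simp_all add: log_hessian_def log_hessian_dx_def,
      (rule exI conjI 11 22 23 33 has_derivative_const
        | simp add: d_inv2_def power2_eq_square power3_eq_cube algebra_simps)+)
  then show thesis using that by blast
qed

definition metric_dx :: "real^3 \<Rightarrow> real^3 \<Rightarrow> 3 \<Rightarrow> 3 \<Rightarrow> real" where
  "metric_dx x y i j = berwald_moor x y *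
    (- 2/3 * y$3 * inv2 x y *
        (2/9 * (log_gradient x y $ i * log_gradient x y $ j) + 1/3 * log_hessian x y $ j $ i)
     + 2/9 * (log_gradient_dx x y $ i * log_gradient x y $ j + log_gradient x y $ i * log_gradient_dx x y $ j)
     + 1/3 * log_hessian_dx x y $ j $ i)"

lemma partial_x_metric_tensor:
  assumes "y \<in> berwald_moor_cone x"
  shows "partial_x k (metric_tensor i j) x y = (if k = 1 then metric_dx x y i j else 0)"
proof -
  obtain D where D: "((\<lambda>p. log_hessian (fst p) (snd p) $ j $ i) has_derivative D) (at (x, y))"
    "\<And>u. D (u, 0) = log_hessian_dx x y $ j $ i * u $ 1"
    using has_derivative_log_hessian_dx[OF assms] by blast
  have "partial_x k (metric_tensor i j) x y = metric_dx x y i j * axis k 1 $ 1"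
    by (subst partials_eqI(2)[OF assms metric_tensor_cone])
      (auto intro!: derivative_eq_intros has_derivative_berwald_moor_bundle[OF assms] D(1)
        has_derivative_log_gradient[OF assms] simp: D(2) metric_dx_def field_simps)
  then show ?thesis by (simp add: axis_def)
qed

text \<open>
  The Euler-Lagrange covector \<open>y\<^sup>k \<partial>\<^sup>2F/\<partial>x\<^sup>k\<partial>y\<^sup>l - \<partial>F/\<partial>x\<^sup>l\<close> of the metric function.
\<close>

definition euler_lagrange :: "real^3 \<Rightarrow> real^3 \<Rightarrow> real^3" where
  "euler_lagrange x y = (2/9 * berwald_moor x y * inv2 x y) *\<^sub>R
     vector [y$3, y$1 * y$3 * inv2 x y, - 5 * y$1 - x$1 * y$1 * y$3 * inv2 x y]"

lemma euler_lagrange_metric: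
  assumes "y \<in> berwald_moor_cone x"
  shows "(\<Sum>j\<in>UNIV. \<Sum>k\<in>UNIV. (2 * partial_x k (metric_tensor j l) x y
    - partial_x l (metric_tensor j k) x y) * y$j * y$k) = euler_lagrange x y $ l"
proof -
  define a where "a = y$2 - x$1 * y$3"
  have nz: "y$1 \<noteq> 0" "a \<noteq> 0" "y$3 \<noteq> 0"
    using assms by (auto simp: berwald_moor_cone_def a_def)
  have y2: "y$2 = a + x$1 * y$3" and inv2: "inv2 x y = 1 / a"
    by (simp_all add: a_def inv2_def divide_inverse)
  show ?thesis
    using exhaust_3[of l] nz
    by (elim disjE)
      (simp_all add: partial_x_metric_tensor[OF assms] sum_3 metric_dx_def euler_lagrange_def
        log_gradient_def log_hessian_def log_gradient_dx_def log_hessian_dx_def y2 inv2,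
       simp_all add: field_simps power2_eq_square power3_eq_cube)
qed

lemma matrix_inv_eqI:
  fixes A B :: "real^'n^'n"
  assumes "A ** B = mat 1"
  shows "matrix_inv A = B"
proof -
  have BA: "B ** A = mat 1"
    using assms matrix_left_right_inverse by blast
  have "A ** matrix_inv A = mat 1"
    unfolding matrix_inv_def by (rule someI2[of _ B]) (use assms BA in auto)
  then have "B = B ** (A ** matrix_inv A)" by simp
  also have "\<dots> = matrix_inv A" by (simp add: matrix_mul_assoc BA)
  finally show ?thesis by simp
qed

text \<open>
  The metric tensor is \<open>F/9 (2 l' l'\<^sup>T - 3 H)\<close> with \<open>H = - l''\<close>, and \<open>H y = l'\<close>, \<open>l' \<cdot> y = 3\<close> by homogeneity. Therefore its
  inverse is \<open>1/F (2 y y\<^sup>T - 3 H\<^sup>-\<^sup>1)\<close>; the explicit matrix below is \<open>H\<^sup>-\<^sup>1\<close>.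
\<close>

definition metric_inverse_matrix :: "real^3 \<Rightarrow> real^3 \<Rightarrow> real^3^3" where
  "metric_inverse_matrix x y = inverse (berwald_moor x y) *\<^sub>R
     (\<chi> i j. 2 * y$i * y$j - 3 * (vector [vector [(y$1)\<^sup>2, 0, 0],
       vector [0, (y$2 - x$1 * y$3)\<^sup>2 + (x$1 * y$3)\<^sup>2, x$1 * (y$3)\<^sup>2],
       vector [0, x$1 * (y$3)\<^sup>2, (y$3)\<^sup>2]] :: real^3^3) $ i $ j)"

lemma metric_inverse_cone:
  assumes "y \<in> berwald_moor_cone x"
  shows "metric_inverse i j x y = metric_inverse_matrix x y $ i $ j"
proof -
  define a where "a = y$2 - x$1 * y$3"
  have nz: "y$1 \<noteq> 0" "a \<noteq> 0" "y$3 \<noteq> 0" "berwald_moor x y \<noteq> 0"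
    using assms by (auto simp: berwald_moor_cone_def berwald_moor_def a_def)
  have y2: "y$2 = a + x$1 * y$3" and inv2: "inv2 x y = 1 / a"
    by (simp_all add: a_def inv2_def divide_inverse)
  have "(\<chi> k l. metric_tensor k l x y) ** metric_inverse_matrix x y = mat 1"
    unfolding vec_eq_iff forall_3 matrix_matrix_mult_def
    using nz by (simp add: metric_tensor_cone[OF assms] sum_3 mat_def metric_inverse_matrix_def
        log_gradient_def log_hessian_def y2 inv2 field_simps power2_eq_square)
  then show ?thesis
    by (simp add: metric_inverse_def matrix_inv_eqI)
qed

text \<open>
  In frame components this is \<open>w/2 (-a\<^sup>1, -a\<^sup>2, a\<^sup>3)\<close> with \<open>w = a\<^sup>1 a\<^sup>3 / a\<^sup>2\<close>.
\<close>

definition spray :: "real^3 \<Rightarrow> real^3 \<Rightarrow> real^3" where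
  "spray x y = (y$1 * y$3 / 2) *\<^sub>R vector [- (y$1 * inv2 x y), x$1 * y$3 * inv2 x y - 1, y$3 * inv2 x y]"

lemma spray_coeff_cone:
  assumes "y \<in> berwald_moor_cone x"
  shows "spray_coeff i x y = spray x y $ i"
proof -
  define a where "a = y$2 - x$1 * y$3"
  have nz: "y$1 \<noteq> 0" "a \<noteq> 0" "y$3 \<noteq> 0" "berwald_moor x y \<noteq> 0"
    using assms by (auto simp: berwald_moor_cone_def berwald_moor_def a_def)
  have y2: "y$2 = a + x$1 * y$3" and inv2: "inv2 x y = 1 / a"
    by (simp_all add: a_def inv2_def divide_inverse)
  have "spray_coeff i x y = 1/4 * (\<Sum>l\<in>UNIV. metric_inverse_matrix x y $ i $ l * euler_lagrange x y $ l)"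
    unfolding spray_coeff_def euler_lagrange_metric[OF assms, symmetric] metric_inverse_cone[OF assms]
    by (simp add: sum_distrib_left mult.assoc)
  also have "\<dots> = spray x y $ i"
    using exhaust_3[of i] nz
    by (elim disjE) (simp_all add: sum_3 metric_inverse_matrix_def euler_lagrange_def spray_def
        y2 inv2 field_simps power2_eq_square)
  finally show ?thesis .
qed

definition connection_matrix :: "real^3 \<Rightarrow> real^3 \<Rightarrow> real^3^3" where
  "connection_matrix x y = (let q = inv2 x y in vector [
     vector [- (y$1 * y$3 * q), (y$1)\<^sup>2 * y$3 * q\<^sup>2 / 2,
       - ((y$1)\<^sup>2 * q / 2) - x$1 * (y$1)\<^sup>2 * y$3 * q\<^sup>2 / 2],
     vector [x$1 * (y$3)\<^sup>2 * q / 2 - y$3 / 2, - (x$1 * y$1 * (y$3)\<^sup>2 * q\<^sup>2 / 2),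
       x$1 * y$1 * y$3 * q + (x$1)\<^sup>2 * y$1 * (y$3)\<^sup>2 * q\<^sup>2 / 2 - y$1 / 2],
     vector [(y$3)\<^sup>2 * q / 2, - (y$1 * (y$3)\<^sup>2 * q\<^sup>2 / 2),
       y$1 * y$3 * q + x$1 * y$1 * (y$3)\<^sup>2 * q\<^sup>2 / 2]])"

text \<open>
  The differential of the connection matrix in both variables; \<open>d1\<close>, \<open>d2\<close>, \<open>d3\<close>, \<open>d4\<close> are the differentials in \<open>y\<close> and
  \<open>q\<close> of \<open>y\<^sup>1 y\<^sup>3 q\<close>, \<open>(y\<^sup>1)\<^sup>2 y\<^sup>3 q\<^sup>2\<close>, \<open>y\<^sup>1 (y\<^sup>3)\<^sup>2 q\<^sup>2\<close> and \<open>(y\<^sup>3)\<^sup>2 q\<close>, monomials that recur in the connection.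
\<close>

definition d_connection_matrix :: "real^3 \<Rightarrow> real^3 \<Rightarrow> (real^3) \<times> (real^3) \<Rightarrow> real^3^3" where
  "d_connection_matrix x y h = (let q = inv2 x y; dq = d_inv2 x y h; u = fst h $ 1; v = snd h;
       d1 = v$1 * y$3 * q + y$1 * v$3 * q + y$1 * y$3 * dq;
       d2 = 2 * y$1 * v$1 * y$3 * q\<^sup>2 + (y$1)\<^sup>2 * v$3 * q\<^sup>2 + 2 * (y$1)\<^sup>2 * y$3 * q * dq;
       d3 = v$1 * (y$3)\<^sup>2 * q\<^sup>2 + 2 * y$1 * y$3 * v$3 * q\<^sup>2 + 2 * y$1 * (y$3)\<^sup>2 * q * dq;
       d4 = 2 * y$3 * v$3 * q + (y$3)\<^sup>2 * dq
     in vector [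
     vector [- d1, d2 / 2,
       - ((2 * y$1 * v$1 * q + (y$1)\<^sup>2 * dq) / 2) - (u * (y$1)\<^sup>2 * y$3 * q\<^sup>2 + x$1 * d2) / 2],
     vector [(u * (y$3)\<^sup>2 * q + x$1 * d4) / 2 - v$3 / 2, - ((u * y$1 * (y$3)\<^sup>2 * q\<^sup>2 + x$1 * d3) / 2),
       u * y$1 * y$3 * q + x$1 * d1 + (2 * x$1 * u * y$1 * (y$3)\<^sup>2 * q\<^sup>2 + (x$1)\<^sup>2 * d3) / 2 - v$1 / 2],
     vector [d4 / 2, - (d3 / 2), d1 + (u * y$1 * (y$3)\<^sup>2 * q\<^sup>2 + x$1 * d3) / 2]])"

lemma has_derivative_spray:
  assumes "y \<in> berwald_moor_cone x"
  obtains D where "((\<lambda>p. spray (fst p) (snd p) $ k) has_derivative D) (at (x, y))"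
    "\<And>j. D (0, axis j 1) = connection_matrix x y $ k $ j"
proof -
  note intros = derivative_eq_intros has_derivative_inv2[OF assms] has_derivative_fst_nth has_derivative_snd_nth
  define D where "D = (\<lambda>h. let q = inv2 x y; dq = d_inv2 x y h; u = fst h $ 1; v = snd h in
    vector [- ((2 * y$1 * v$1 * y$3 * q + (y$1)\<^sup>2 * v$3 * q + (y$1)\<^sup>2 * y$3 * dq) / 2),
      (u * y$1 * (y$3)\<^sup>2 * q + x$1 * (v$1 * (y$3)\<^sup>2 * q + 2 * y$1 * y$3 * v$3 * q + y$1 * (y$3)\<^sup>2 * dq)
        - v$1 * y$3 - y$1 * v$3) / 2,
      (v$1 * (y$3)\<^sup>2 * q + 2 * y$1 * y$3 * v$3 * q + y$1 * (y$3)\<^sup>2 * dq) / 2] :: real^3)"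
  have "((\<lambda>p. spray (fst p) (snd p) $ k) has_derivative (\<lambda>h. D h $ k)) (at (x, y))"
    using exhaust_3[of k]
    by (elim disjE; simp add: spray_def D_def Let_def;
        auto intro!: intros simp: fun_eq_iff field_simps power2_eq_square)
  moreover have "D (0, axis j 1) $ k = connection_matrix x y $ k $ j" for j
    using exhaust_3[of k] exhaust_3[of j]
    by (elim disjE) (simp_all add: D_def connection_matrix_def d_inv2_def Let_def axis_def
        field_simps power2_eq_square)
  ultimately show thesis by (rule that)
qed

lemma connection_cone:
  assumes "y \<in> berwald_moor_cone x"
  shows "connection k j x y = connection_matrix x y $ k $ j"
proof -
  obtain D where D: "((\<lambda>p. spray (fst p) (snd p) $ k) has_derivative D) (at (x, y))"
    "\<And>j. D (0, axis j 1) = connection_matrix x y $ k $ j"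
    using has_derivative_spray[OF assms] by blast
  show ?thesis
    using partials_eqI(1)[OF assms spray_coeff_cone D(1)] by (simp add: connection_def D(2))
qed

lemma has_derivative_connection_matrix:
  assumes "y \<in> berwald_moor_cone x"
  shows "((\<lambda>p. connection_matrix (fst p) (snd p) $ k $ j) has_derivative
    (\<lambda>h. d_connection_matrix x y h $ k $ j)) (at (x, y))"
proof -
  note intros = derivative_eq_intros has_derivative_inv2[OF assms] has_derivative_fst_nth has_derivative_snd_nth
  show ?thesis
    using exhaust_3[of k] exhaust_3[of j]
    by (elim disjE; simp add: connection_matrix_def d_connection_matrix_def Let_def;
        auto intro!: intros simp: fun_eq_iff field_simps power2_eq_square)
qed

lemma curvature_cone:
  assumes "y \<in> berwald_moor_cone x"
  shows "curvature k i j x y = d_connection_matrix x y (axis j 1, 0) $ k $ i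
    - d_connection_matrix x y (axis i 1, 0) $ k $ j
    + (\<Sum>m\<in>UNIV. connection_matrix x y $ m $ i * d_connection_matrix x y (0, axis m 1) $ k $ j
        - connection_matrix x y $ m $ j * d_connection_matrix x y (0, axis m 1) $ k $ i)"
proof -
  have "partial_y m (connection k j) x y = d_connection_matrix x y (0, axis m 1) $ k $ j"
    "partial_x m (connection k j) x y = d_connection_matrix x y (axis m 1, 0) $ k $ j" for m k j
    using partials_eqI[where f = "connection k j", OF assms connection_cone
        has_derivative_connection_matrix[OF assms]] by simp_all
  then show ?thesis
    by (simp only: curvature_def connection_cone[OF assms])
qed

text \<open>
  The second frame vector is \<open>\<partial>\<^sub>2\<close> and the third is \<open>\<partial>\<^sub>3 + x\<^sup>1 \<partial>\<^sub>2\<close>. The left-hand sides are the curvature evaluated on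
  pairs of frame vectors, which is where it reduces to single monomial fields.
\<close>

lemma curvature_monomial:
  assumes "y \<in> berwald_moor_cone x"
  shows "curvature k 1 2 x y = (monomial x (vector [1,-3,2]) y *\<^sub>R dilate x (vector [-5/4, 1/4, 1]) y) $ k"
    and "curvature k 2 3 x y = (monomial x (vector [2,-3,1]) y *\<^sub>R dilate x (vector [-1, -1/4, 5/4]) y) $ k"
    and "curvature k 1 3 x y + x$1 * curvature k 1 2 x y
      = (monomial x (vector [1,-2,1]) y *\<^sub>R dilate x (vector [11/4, 0, -11/4]) y) $ k"
proof -
  define a where "a = y$2 - x$1 * y$3"
  have nz: "y$1 \<noteq> 0" "a \<noteq> 0" "y$3 \<noteq> 0"
    using assms by (auto simp: berwald_moor_cone_def a_def)
  have y2: "y$2 = a + x$1 * y$3" and inv2: "inv2 x y = 1 / a"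
    by (simp_all add: a_def inv2_def divide_inverse)
  note simps = curvature_cone[OF assms] connection_matrix_def d_connection_matrix_def d_inv2_def Let_def
    sum_3 axis_def dilate_def y2 inv2
  have m: "monomial x (vector [1,-3,2]) y = y$1 * (y$3)\<^sup>2 / a^3"
    "monomial x (vector [2,-3,1]) y = (y$1)\<^sup>2 * y$3 / a^3"
    "monomial x (vector [1,-2,1]) y = y$1 * y$3 / a\<^sup>2"
    by (simp_all add: monomial_def prod_UNIV_3 power_int_minus y2 divide_inverse)
  show "curvature k 1 2 x y = (monomial x (vector [1,-3,2]) y *\<^sub>R dilate x (vector [-5/4, 1/4, 1]) y) $ k"
    using exhaust_3[of k] nz by (elim disjE; simp add: m simps; simp add: field_simps power2_eq_square power3_eq_cube)
  show "curvature k 2 3 x y = (monomial x (vector [2,-3,1]) y *\<^sub>R dilate x (vector [-1, -1/4, 5/4]) y) $ k"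
    using exhaust_3[of k] nz by (elim disjE; simp add: m simps; simp add: field_simps power2_eq_square power3_eq_cube)
  show "curvature k 1 3 x y + x$1 * curvature k 1 2 x y
      = (monomial x (vector [1,-2,1]) y *\<^sub>R dilate x (vector [11/4, 0, -11/4]) y) $ k"
    using exhaust_3[of k] nz by (elim disjE; simp add: m simps; simp add: field_simps power2_eq_square power3_eq_cube)
qed

lemma curvature_antisym: "curvature k j i x y = - curvature k i j x y"
  by (simp add: curvature_def sum_subtractf)

section \<open>The curvature algebra\<close>

lemma curvature_field_monomial:
  "curvature_field x X Y =
     scale_field (X$1 * Y$2 - X$2 * Y$1 - x$1 * (X$1 * Y$3 - X$3 * Y$1))
       (monomial_field x (vector [1,-3,2]) (vector [-5/4, 1/4, 1]))
   + scale_field (X$1 * Y$3 - X$3 * Y$1) (monomial_field x (vector [1,-2,1]) (vector [11/4, 0, -11/4]))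
   + scale_field (X$2 * Y$3 - X$3 * Y$2) (monomial_field x (vector [2,-3,1]) (vector [-1, -1/4, 5/4]))"
proof
  fix y
  show "curvature_field x X Y y = (scale_field (X$1 * Y$2 - X$2 * Y$1 - x$1 * (X$1 * Y$3 - X$3 * Y$1))
       (monomial_field x (vector [1,-3,2]) (vector [-5/4, 1/4, 1]))
   + scale_field (X$1 * Y$3 - X$3 * Y$1) (monomial_field x (vector [1,-2,1]) (vector [11/4, 0, -11/4]))
   + scale_field (X$2 * Y$3 - X$3 * Y$2) (monomial_field x (vector [2,-3,1]) (vector [-1, -1/4, 5/4]))) y"
  proof (cases "y \<in> indicatrix x")
    case True
    then have cone: "y \<in> berwald_moor_cone x" using indicatrix_subset_cone by blast
    have 0: "curvature k i i x y = 0" for k i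
      using curvature_antisym[of k i i x y] by simp
    have "(\<Sum>i\<in>UNIV. \<Sum>j\<in>UNIV. curvature k i j x y * X$i * Y$j)
      = (X$1 * Y$2 - X$2 * Y$1 - x$1 * (X$1 * Y$3 - X$3 * Y$1)) * curvature k 1 2 x y
      + (X$1 * Y$3 - X$3 * Y$1) * (curvature k 1 3 x y + x$1 * curvature k 1 2 x y)
      + (X$2 * Y$3 - X$3 * Y$2) * curvature k 2 3 x y" for k
      by (simp add: sum_3 0 curvature_antisym[of k 2 1] curvature_antisym[of k 3 1]
          curvature_antisym[of k 3 2] algebra_simps)
    note this[unfolded curvature_monomial(3)[OF cone], unfolded curvature_monomial(1,2)[OF cone]]
    then show ?thesis
      using True by (simp add: curvature_field_def scale_field_def monomial_field_def vec_eq_iff)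
  qed (simp add: curvature_field_def scale_field_def monomial_field_def)
qed

lemma curvature_field_in_smooth_fields: "curvature_field x X Y \<in> smooth_fields x"
  unfolding curvature_field_monomial
  by (intro vfield.subspace_add[OF subspace_smooth_fields] vfield.subspace_scale[OF subspace_smooth_fields]
      monomial_field_in_smooth_fields) (simp_all add: sum_3)

lemma monomial_field_scale: "monomial_field x m (r *\<^sub>R c) = scale_field r (monomial_field x m c)"
  by (auto simp: fun_eq_iff monomial_field_def scale_field_def dilate_def vec_eq_iff forall_3 algebra_simps)

theorem proposition18:
  fixes x :: "real^3"
  shows "lie_subalgebra x (curvature_algebra x) \<and> infinite_dimensional (curvature_algebra x)"
proof
  let ?C = "curvature_algebra x"
  have gen: "curvature_field x X Y \<in> ?C" for X Y
    unfolding curvature_algebra_def by (rule hull_inc) blast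
  show C: "lie_subalgebra x ?C"
    unfolding curvature_algebra_def
    by (rule lie_subalgebra_hull) (use curvature_field_in_smooth_fields in blast)
  \<comment> \<open>The arguments are pairs of left-invariant frame vectors at \<open>x\<close>.\<close>
  have V12: "monomial_field x (vector [1,-3,2]) (vector [-5/4, 1/4, 1]) \<in> ?C"
    using gen[of "vector [1,0,0]" "vector [0,1,0]"] by (simp add: curvature_field_monomial)
  have "monomial_field x (vector [1,-2,1]) (vector [11/4, 0, -11/4]) \<in> ?C"
    using gen[of "vector [1,0,0]" "vector [0,x$1,1]"] by (simp add: curvature_field_monomial)
  then have "scale_field (4/11) (monomial_field x (vector [1,-2,1]) (vector [11/4, 0, -11/4])) \<in> ?C"
    using C vfield.subspace_scale by (auto simp: lie_subalgebra_def)
  moreover have "(4/11::real) *\<^sub>R (vector [11/4, 0, -11/4] :: real^3) = vector [1, 0, -1]"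
    by (simp add: vec_eq_iff forall_3)
  ultimately have V13: "monomial_field x (vector [1,-2,1]) (vector [1, 0, -1]) \<in> ?C"
    by (simp only: monomial_field_scale[symmetric])
  have "monomial_field x (vector [1 + int k, -3 - 2 * int k, 2 + int k]) (ladder_coeff k) \<in> ?C" for k
  proof (induction k)
    case 0
    then show ?case using V12 by (simp add: ladder_coeff_def)
  next
    case (Suc k)
    then have "lie_bracket x (monomial_field x (vector [1,-2,1]) (vector [1,0,-1]))
      (monomial_field x (vector [1 + int k, -3 - 2 * int k, 2 + int k]) (ladder_coeff k)) \<in> ?C"
      using C V13 by (simp add: lie_subalgebra_def)
    then show ?case by (simp only: lie_bracket_ladder)
  qed
  then show "infinite_dimensional ?C"
    by (rule infinite_dimensional_ladder)
qed

end
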